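(* Let $N\in\mathbb{N}$, $n\in\{1,\dots,N\}$ and let $Z=(z_{j,k})\in\mathbb{C}^{N\times n}$ satisfy $|z_{j,k}|\le 1$ for all $j\in\{1,\dots,N\}$, $k\in\{1,\dots,n\}$. Set $\widetilde z_k=\frac1N\sum_{j=1}^N z_{j,k}$, $a_{j,k}=z_{j,k}-\widetilde z_k$, $$\alpha=\frac{1}{nN}\sum_{j=1}^N\sum_{k=1}^n|a_{j,k}|^2,\qquad \beta=\frac1n\sum_{k=1}^n|\widetilde z_k|^2,$$ $$\gamma(d)=\frac{n\alpha}{N}\min\Big\{dn,\frac{1}{1-\beta}\Big\}\quad(d\in(0,\infty)),\qquad \gamma=\gamma(1).$$ If $\gamma<1$, then $$\Big|\frac{(N-n)!}{N!}\mathrm{Per}(Z)-\prod_{k=1}^n\widetilde z_k\Big|\le\gamma(1/2)+\frac{3^{1/4}\,C_3\,\gamma^{3/2}}{(1-\gamma)^{3/4}},$$ and, if moreover $n\ge2$, $$\Big|\frac{(N-n)!}{N!}\mathrm{Per}(Z)-H_2(Z)\Big|\le\sqrt3\sum_{j=1}^N\Big(\frac{1}{N^2}\sum_{k=1}^n|a_{j,k}|^2\min\Big\{\frac n3,\frac1{1-\beta}\Big\}\Big)^{3/2}+\frac{2^{1/2}\,C_4\,\gamma^2}{(1-\gamma)^{3/4}},$$ where $H_2(Z)=\sum_{m=0}^{2}G_m(Z)$.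
   Context: For $r\in\mathbb{N}=\{1,2,\dots\}$, $C_r=\Big(\frac{\mathrm{e}^r\,r!}{r^{r+1/2}}\Big)^{1/2}$. The permanent of a rectangular matrix $Z=(z_{j,k})\in\mathbb{C}^{N\times n}$, $n\le N$, is $\mathrm{Per}(Z)=\sum\prod_{k=1}^n z_{j_k,k}$, the sum being over all $(j_1,\dots,j_n)\in\{1,\dots,N\}^n$ with pairwise distinct entries. For indeterminates $x=(x_1,\dots,x_n)$ let $U_j(x)=\sum_{k=1}^n a_{j,k}x_k$, and for $m\in\{0,\dots,n\}$ let $$G_m(Z)=\frac{(N-m)!}{(n-m)!\,N!}\,\mathrm{Coeff}\Big(x_1\cdots x_n;\ \Big(\prod_{j=1}^N(1+U_j(x))\Big)\Big(\sum_{k=1}^n\widetilde z_kx_k\Big)^{n-m}\Big),$$ where $\mathrm{Coeff}(x_1\cdots x_n;\,p)$ denotes the coefficient of the monomial $x_1x_2\cdots x_n$ in the polynomial $p$. Explicitly, for $n\ge2$, $$H_2(Z)=\prod_{k=1}^n\widetilde z_k-\frac{1}{N(N-1)}\sum_{K\subseteq\{1,\dots,n\}:\,|K|=2}\Big(\sum_{j=1}^N\prod_{k\in K}a_{j,k}\Big)\prod_{k\in\{1,\dots,n\}\setminus K}\widetilde z_k.$$ Conventions: $0^0=1$; the zeroth power of a polynomial is $1$; $\frac{1}{1-\beta}$ is read as $+\infty$ if $\beta=1$. *)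

theory Defs
  imports Complex_Main "HOL-Library.FuncSet" "HOL-Library.Poly_Mapping"
begin

text \<open>
  An \<open>N \<times> n\<close> matrix is a function \<open>Z :: nat \<Rightarrow> nat \<Rightarrow> complex\<close> of which only the entries
  \<open>Z j k\<close> with \<open>1 \<le> j \<le> N\<close> and \<open>1 \<le> k \<le> n\<close> matter.
\<close>

text \<open>Tuples \<open>(j\<^sub>1, \<dots>, j\<^sub>n)\<close> of row indices are extensional functions on \<open>{1..n}\<close>.\<close>

definition Per :: "nat \<Rightarrow> nat \<Rightarrow> (nat \<Rightarrow> nat \<Rightarrow> complex) \<Rightarrow> complex" where
  "Per N n Z = (\<Sum>J \<in> {J \<in> {1..n} \<rightarrow>\<^sub>E {1..N}. inj_on J {1..n}}. \<Prod>k=1..n. Z (J k) k)"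

definition col_mean :: "nat \<Rightarrow> (nat \<Rightarrow> nat \<Rightarrow> complex) \<Rightarrow> nat \<Rightarrow> complex" where
  "col_mean N Z k = 1 / of_nat N * (\<Sum>j=1..N. Z j k)"

definition centred :: "nat \<Rightarrow> (nat \<Rightarrow> nat \<Rightarrow> complex) \<Rightarrow> nat \<Rightarrow> nat \<Rightarrow> complex" where
  "centred N Z j k = Z j k - col_mean N Z k"

definition alpha :: "nat \<Rightarrow> nat \<Rightarrow> (nat \<Rightarrow> nat \<Rightarrow> complex) \<Rightarrow> real" where
  "alpha N n Z = 1 / (real n * real N) * (\<Sum>j=1..N. \<Sum>k=1..n. (cmod (centred N Z j k))\<^sup>2)"

definition beta :: "nat \<Rightarrow> nat \<Rightarrow> (nat \<Rightarrow> nat \<Rightarrow> complex) \<Rightarrow> real" where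
  "beta N n Z = 1 / real n * (\<Sum>k=1..n. (cmod (col_mean N Z k))\<^sup>2)"

text \<open>
  \<open>min_factor N n Z d\<close> is \<open>min {d n, 1 / (1 - \<beta>)}\<close>, where \<open>1 / (1 - \<beta>)\<close> is read as \<open>+\<infinity>\<close>
  if \<open>\<beta> = 1\<close> (division by zero in \<^typ>\<open>real\<close> would give \<open>0\<close> instead).
\<close>

definition min_factor :: "nat \<Rightarrow> nat \<Rightarrow> (nat \<Rightarrow> nat \<Rightarrow> complex) \<Rightarrow> real \<Rightarrow> real" where
  "min_factor N n Z d =
    (if beta N n Z = 1 then d * real n else min (d * real n) (1 / (1 - beta N n Z)))"

definition gam :: "nat \<Rightarrow> nat \<Rightarrow> (nat \<Rightarrow> nat \<Rightarrow> complex) \<Rightarrow> real \<Rightarrow> real" where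
  "gam N n Z d = real n * alpha N n Z / real N * min_factor N n Z d"

definition C :: "nat \<Rightarrow> real" where
  "C r = sqrt (exp (real r) * fact r / real r powr (real r + 1 / 2))"

text \<open>
  Polynomials in the indeterminates \<open>x\<^sub>k\<close>, \<open>k :: nat\<close>: finitely supported maps from monomials to
  coefficients, a monomial being a finitely supported map from indices to exponents.
\<close>

type_synonym cpoly = "(nat \<Rightarrow>\<^sub>0 nat) \<Rightarrow>\<^sub>0 complex"

text \<open>The linear form \<open>c\<^sub>1 x\<^sub>1 + \<dots> + c\<^sub>n x\<^sub>n\<close>.\<close>

definition linear_form :: "nat \<Rightarrow> (nat \<Rightarrow> complex) \<Rightarrow> cpoly" where
  "linear_form n c = (\<Sum>k=1..n. Poly_Mapping.single (Poly_Mapping.single k 1) (c k))"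

text \<open>The coefficient of \<open>x\<^sub>1 x\<^sub>2 \<cdots> x\<^sub>n\<close>.\<close>

definition Coeff :: "nat \<Rightarrow> cpoly \<Rightarrow> complex" where
  "Coeff n p = Poly_Mapping.lookup p (\<Sum>k=1..n. Poly_Mapping.single k 1)"

text \<open>Meaningful for \<open>m \<le> n \<le> N\<close> only, because of the truncated subtractions.\<close>

definition G :: "nat \<Rightarrow> nat \<Rightarrow> (nat \<Rightarrow> nat \<Rightarrow> complex) \<Rightarrow> nat \<Rightarrow> complex" where
  "G N n Z m = fact (N - m) / (fact (n - m) * fact N) *
    Coeff n ((\<Prod>j=1..N. 1 + linear_form n (centred N Z j)) *
             linear_form n (col_mean N Z) ^ (n - m))"

definition H2 :: "nat \<Rightarrow> nat \<Rightarrow> (nat \<Rightarrow> nat \<Rightarrow> complex) \<Rightarrow> complex" where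
  "H2 N n Z = (\<Sum>m=0..2. G N n Z m)"

end

theory Submission
  imports Defs "HOL-Analysis.Analysis"
begin

text \<open>
  Write \<open>a\<^sub>j\<^sub>k\<close> for the centred entries, \<open>m\<^sub>k\<close> for the column means, \<open>\<sigma>\<^sub>k = N\<^sup>-\<^sup>1 \<Sum>\<^sub>j |a\<^sub>j\<^sub>k|\<^sup>2\<close>, and
  \<open>A\<^sub>K\<close> for the centred matrix restricted to the columns in \<open>K\<close>.  Expanding \<open>z\<^sub>j\<^sub>k = a\<^sub>j\<^sub>k + m\<^sub>k\<close> column by
  column turns the normalised permanent into \<open>\<Sum>\<^sub>p G\<^sub>p\<close>, where \<open>G\<^sub>p\<close> is \<open>(N-p)!/N!\<close> times the sum of
  \<open>Per(A\<^sub>K) \<Prod>\<^sub>k\<^sub>\<notin>\<^sub>K m\<^sub>k\<close> over the sets \<open>K\<close> of \<open>p\<close> columns (\<open>Per_eq_sum_G\<close>, \<open>G_eq_sum_inj_sum\<close>).  Here \<open>G\<^sub>0\<close> is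
  the product of the means, and \<open>G\<^sub>1\<close> vanishes because centred columns sum to zero.  So both claims are
  bounds for the terms with \<open>p \<ge> 2\<close>.

  The heart is a Hadamard type inequality for columns with sum zero
  (\<open>inj_sum_zero_sum_columns_bound\<close>): with \<open>D\<^sub>p = p! (e/p)\<^sup>p\<close>,
  \<open>|Per(A\<^sub>K)|\<^sup>2 \<le> p! D\<^sub>p N!/(N-p)! \<Prod>\<^sub>k\<^sub>\<in>\<^sub>K \<sigma>\<^sub>k\<close>.  The permanent is a symmetric multilinear form in its columns,
  and on a Hilbert space such a form attains its norm at equal arguments, a theorem of Banach
  (\<open>symmetric_multilinear_bound\<close>).  For \<open>p\<close> equal columns \<open>f\<close> the permanent is \<open>p!\<close> times the elementary
  symmetric sum of \<open>f\<close>, a coefficient of \<open>\<Prod>\<^sub>j (1 + w f\<^sub>j)\<close>.  On a circle \<open>|w| = \<rho>\<close> the inequality of the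
  arithmetic and geometric means bounds the squared modulus of this product by
  \<open>(1 + \<rho>\<^sup>2 |f|\<^sup>2 / N)\<^sup>N\<close>: the linear terms cancel since \<open>f\<close> has sum zero.  The best \<open>\<rho>\<close> gives the bound.

  By the Cauchy-Schwarz inequality over \<open>K\<close>, \<open>|G\<^sub>p|\<^sup>2 \<le> D\<^sub>p (n/N)\<^sup>p W\<^sub>p\<close>, where \<open>W\<^sub>p\<close> is the coefficient of \<open>t\<^sup>p\<close>
  in \<open>\<Prod>\<^sub>k (|m\<^sub>k|\<^sup>2 + t \<sigma>\<^sub>k)\<close> (\<open>G_square_le\<close>).  If \<open>\<gamma> > 0\<close> and \<open>t = n/(N\<gamma>)\<close>, the numbers \<open>t\<^sup>p W\<^sub>p\<close> with \<open>p \<ge> 2\<close> have sum at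
  most \<open>1\<close>: if the minimum in \<open>\<gamma>\<close> is \<open>1/(1-\<beta>)\<close>, the whole product is at most \<open>(\<beta> + t\<alpha>)\<^sup>n = 1\<close>; if it is
  \<open>n\<close>, the inequality of Maclaurin makes the single numbers at most \<open>1/p!\<close>.  A second application of
  Cauchy-Schwarz, now over \<open>p\<close>, therefore bounds \<open>\<Sum>\<^sub>p\<^sub>\<ge>\<^sub>r |G\<^sub>p|\<close> by the square root of \<open>\<Sum>\<^sub>p\<^sub>\<ge>\<^sub>r D\<^sub>p \<gamma>\<^sup>p\<close>, and
  comparison with the binomial series bounds the latter by \<open>D\<^sub>r \<gamma>\<^sup>r (1-\<gamma>)\<^sup>-\<^sup>3\<^sup>/\<^sup>2\<close>.  As
  \<open>D\<^sub>r = \<surd>r C\<^sub>r\<^sup>2\<close>, the cases \<open>r = 3\<close> and \<open>r = 4\<close> are the error terms of the two claims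
  (\<open>tail_bound\<close>, \<open>remainder_eq_sqrt\<close>).

  The remaining terms \<open>G\<^sub>2\<close> and \<open>G\<^sub>3\<close> get sharper bounds, because the permanents of two and three
  zero-sum columns are explicit: \<open>-\<Sum>\<^sub>j a\<^sub>j\<^sub>k a\<^sub>j\<^sub>l\<close> and \<open>2 \<Sum>\<^sub>j a\<^sub>j\<^sub>k a\<^sub>j\<^sub>l a\<^sub>j\<^sub>q\<close>.
\<close>

section \<open>Sums over injections\<close>

definition injections :: "nat set \<Rightarrow> nat set \<Rightarrow> (nat \<Rightarrow> nat) set" where
  "injections K R = {J \<in> K \<rightarrow>\<^sub>E R. inj_on J K}"

text \<open>
  The permanent of the matrix with columns \<open>X k\<close>, \<open>k \<in> K\<close>, and rows \<open>R\<close>.  The column index comes first, so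
  that columns can be exchanged by function update, and \<open>K\<close> and \<open>R\<close> vary freely, as the recursions below
  require.
\<close>

definition inj_sum :: "nat set \<Rightarrow> nat set \<Rightarrow> (nat \<Rightarrow> nat \<Rightarrow> complex) \<Rightarrow> complex" where
  "inj_sum K R X = (\<Sum>J\<in>injections K R. \<Prod>k\<in>K. X k (J k))"

lemma finite_injections: "finite K \<Longrightarrow> finite R \<Longrightarrow> finite (injections K R)"
  unfolding injections_def by (rule finite_subset[of _ "K \<rightarrow>\<^sub>E R"]) (auto intro: finite_PiE)

lemma injections_empty: "injections {} R = {\<lambda>_. undefined}"
  unfolding injections_def by auto

lemma inj_sum_empty [simp]: "inj_sum {} R X = 1"
  by (simp add: inj_sum_def injections_empty)

lemma inj_sum_cong:
  assumes "\<And>k j. k \<in> K \<Longrightarrow> j \<in> R \<Longrightarrow> X k j = Y k j"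
  shows "inj_sum K R X = inj_sum K R Y"
  unfolding inj_sum_def using assms
  by (intro sum.cong refl prod.cong) (auto simp: injections_def PiE_def Pi_def)

lemma sum_injections_insert:
  fixes F :: "(nat \<Rightarrow> nat) \<Rightarrow> 'b::comm_monoid_add"
  assumes fin: "finite K" "finite R" and k: "k \<notin> K"
  shows "(\<Sum>J\<in>injections (insert k K) R. F J)
       = (\<Sum>J\<in>injections K R. \<Sum>j\<in>R - J ` K. F (J(k := j)))"
proof -
  have "(\<Sum>J\<in>injections K R. \<Sum>j\<in>R - J ` K. F (J(k := j)))
      = (\<Sum>(J, j)\<in>(SIGMA J:injections K R. R - J ` K). F (J(k := j)))"
    using fin by (subst sum.Sigma) (auto simp: finite_injections)
  also have "\<dots> = (\<Sum>J\<in>injections (insert k K) R. F J)"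
  proof (rule sum.reindex_bij_witness[where i = "\<lambda>J. (restrict J K, J k)" and j = "\<lambda>(J, j). J(k := j)"],
      goal_cases)
    case (1 a)
    obtain J j where a: "a = (J, j)" by force
    show ?case using 1 k unfolding a
      by (auto simp: injections_def PiE_def extensional_def restrict_def fun_eq_iff)
  next
    case (2 a)
    obtain J j where a: "a = (J, j)" by force
    have "J(k := j) \<in> insert k K \<rightarrow>\<^sub>E R"
      using 2 unfolding a injections_def by (auto simp: PiE_def extensional_def)
    moreover have "inj_on (J(k := j)) (insert k K)"
      using 2 k unfolding a injections_def by (auto simp: inj_on_def)
    ultimately show ?case unfolding a injections_def by simp
  next
    case (3 J)
    show ?case using 3 k
      by (auto simp: injections_def PiE_def extensional_def restrict_def fun_eq_iff)
  next
    case (4 J)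
    have "J k \<notin> restrict J K ` K"
      using 4 k unfolding injections_def inj_on_def by auto
    moreover have "restrict J K \<in> injections K R"
      using 4 by (auto simp: injections_def inj_on_def)
    ultimately show ?case using 4 by (auto simp: injections_def)
  next
    case (5 a)
    then show ?case by (auto split: prod.splits)
  qed
  finally show ?thesis by simp
qed

text \<open>
  An injection into \<open>insert r R\<close> either avoids \<open>r\<close> or takes it at exactly one column \<open>k\<close>; deleting \<open>k\<close>
  leaves an injection into \<open>R\<close>.  The coefficients of
  the product of the linear factors \<open>1 + U\<^sub>j\<close> obey the same recursion.
\<close>

lemma inj_sum_insert_row:
  assumes fin: "finite K" "finite R" and r: "r \<notin> R"
  shows "inj_sum K (insert r R) X = inj_sum K R X + (\<Sum>k\<in>K. X k r * inj_sum (K - {k}) R X)"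
proof -
  let ?P = "\<lambda>J. \<Prod>k\<in>K. X k (J k)"
  let ?A = "{J \<in> injections K (insert r R). r \<in> J ` K}"
  have rows: "injections K (insert r R) = injections K R \<union> ?A"
    by (auto simp: injections_def PiE_iff)
  have "inj_sum K (insert r R) X = sum ?P (injections K R) + sum ?P ?A"
    unfolding inj_sum_def
  proof (subst rows, rule sum.union_disjoint)
    show "finite (injections K R)" "finite ?A" using fin by (auto simp: finite_injections)
    have "r \<notin> J ` K" if "J \<in> injections K R" for J
      using that r unfolding injections_def by (auto simp: PiE_def Pi_def)
    then show "injections K R \<inter> ?A = {}" by blast
  qed
  also have "sum ?P ?A = (\<Sum>(k, J)\<in>(SIGMA k:K. injections (K - {k}) R). X k r * (\<Prod>i\<in>K - {k}. X i (J i)))"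
  proof (rule sum.reindex_bij_witness[symmetric, where
        i = "\<lambda>J. (the_inv_into K J r, restrict J (K - {the_inv_into K J r}))" and j = "\<lambda>(k, J). J(k := r)"],
      goal_cases)
    case (1 a)
    obtain k J where a: "a = (k, J)" by force
    have "inj_on (J(k := r)) K"
      using 1 r unfolding a injections_def by (auto simp: inj_on_def PiE_def Pi_def)
    moreover have "k \<in> K" using 1 a by auto
    ultimately have "the_inv_into K (J(k := r)) r = k"
      by (metis fun_upd_same the_inv_into_f_eq)
    then show ?case using 1 unfolding a
      by (auto simp: injections_def PiE_def extensional_def restrict_def fun_eq_iff)
  next
    case (2 a)
    obtain k J where a: "a = (k, J)" by force
    have "inj_on (J(k := r)) K"
      using 2 r unfolding a injections_def by (auto simp: inj_on_def PiE_def Pi_def)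
    moreover have "k \<in> K" using 2 a by auto
    moreover have "J(k := r) \<in> K \<rightarrow>\<^sub>E insert r R"
      using 2 unfolding a injections_def by (auto simp: PiE_iff extensional_def)
    ultimately show ?case unfolding a injections_def by force
  next
    case (3 J)
    then have i: "inj_on J K" "r \<in> J ` K" by (auto simp: injections_def)
    then have "J (the_inv_into K J r) = r" by (rule f_the_inv_into_f)
    moreover have "the_inv_into K J r \<in> K" using i by (meson subsetI the_inv_into_into)
    ultimately show ?case using 3
      by (auto simp: injections_def PiE_def extensional_def restrict_def fun_eq_iff)
  next
    case (4 J)
    then have i: "inj_on J K" "r \<in> J ` K" by (auto simp: injections_def)
    then have e: "J (the_inv_into K J r) = r" by (rule f_the_inv_into_f)
    have m: "the_inv_into K J r \<in> K" using i by (meson subsetI the_inv_into_into)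
    have "J x \<in> R" if "x \<in> K" "x \<noteq> the_inv_into K J r" for x
      using 4 that i e m by (auto simp: injections_def inj_on_def PiE_def Pi_def)
    then show ?case using m i
      by (auto simp: injections_def inj_on_def)
  next
    case (5 a)
    obtain k J where a: "a = (k, J)" by force
    have k: "k \<in> K" using 5 a by auto
    have "(\<Prod>i\<in>K. X i ((J(k := r)) i)) = X k r * (\<Prod>i\<in>K - {k}. X i ((J(k := r)) i))"
      using k fin by (subst prod.remove[of _ k]) auto
    also have "(\<Prod>i\<in>K - {k}. X i ((J(k := r)) i)) = (\<Prod>i\<in>K - {k}. X i (J i))"
      by (intro prod.cong) auto
    finally show ?case unfolding a by simp
  qed
  also have "\<dots> = (\<Sum>k\<in>K. X k r * inj_sum (K - {k}) R X)"
    using fin by (subst sum.Sigma[symmetric]) (auto simp: finite_injections inj_sum_def sum_distrib_left)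
  finally show ?thesis by (simp add: inj_sum_def)
qed

lemma inj_sum_insert_column:
  assumes fin: "finite K" "finite R" and k: "k \<notin> K"
  shows "inj_sum (insert k K) R X
    = (\<Sum>J\<in>injections K R. (\<Prod>i\<in>K. X i (J i)) * (\<Sum>j\<in>R - J ` K. X k j))"
proof -
  have "(\<Prod>i\<in>insert k K. X i ((J(k := j)) i)) = (\<Prod>i\<in>K. X i (J i)) * X k j" for J j
  proof -
    have "(\<Prod>i\<in>K. X i ((J(k := j)) i)) = (\<Prod>i\<in>K. X i (J i))"
      using k by (intro prod.cong) auto
    then show ?thesis using k fin by simp
  qed
  then show ?thesis unfolding inj_sum_def
    by (subst sum_injections_insert[OF fin k]) (simp add: sum_distrib_left)
qed

text \<open>
  The new column may use any row that the old columns leave free.  Since it sums to zero, this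
  amounts to subtracting its entries in the occupied rows, and each of these merges with the column
  that occupies the row.
\<close>

lemma inj_sum_insert_zero_sum_column:
  assumes fin: "finite K" "finite R" and k: "k \<notin> K" and zero: "(\<Sum>j\<in>R. X k j) = 0"
  shows "inj_sum (insert k K) R X = - (\<Sum>i\<in>K. inj_sum K R (X(i := \<lambda>j. X i j * X k j)))"
proof -
  have "(\<Sum>j\<in>R - J ` K. X k j) = - (\<Sum>i\<in>K. X k (J i))" if "J \<in> injections K R" for J
  proof -
    have J: "inj_on J K" "J ` K \<subseteq> R" using that by (auto simp: injections_def)
    have "(\<Sum>j\<in>R. X k j) = (\<Sum>j\<in>R - J ` K. X k j) + (\<Sum>j\<in>J ` K. X k j)"
      using J fin by (subst sum.subset_diff) auto
    then show ?thesis using zero J by (simp add: sum.reindex eq_neg_iff_add_eq_0)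
  qed
  then have "inj_sum (insert k K) R X = (\<Sum>J\<in>injections K R. - (\<Sum>i\<in>K. (\<Prod>l\<in>K. X l (J l)) * X k (J i)))"
    by (subst inj_sum_insert_column[OF fin k]) (simp add: sum_distrib_left)
  also have "\<dots> = - (\<Sum>i\<in>K. \<Sum>J\<in>injections K R. (\<Prod>l\<in>K. X l (J l)) * X k (J i))"
    by (subst sum.swap) (simp add: sum_negf)
  also have "\<dots> = - (\<Sum>i\<in>K. inj_sum K R (X(i := \<lambda>j. X i j * X k j)))"
  proof -
    have "(\<Prod>l\<in>K. X l (J l)) * X k (J i) = (\<Prod>l\<in>K. (X(i := \<lambda>j. X i j * X k j)) l (J l))"
      if "i \<in> K" for i J
    proof -
      have "(\<Prod>l\<in>K. (X(i := \<lambda>j. X i j * X k j)) l (J l)) = X i (J i) * X k (J i) * (\<Prod>l\<in>K - {i}. X l (J l))"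
        using that fin by (subst prod.remove[of _ i]) (auto intro!: prod.cong)
      moreover have "(\<Prod>l\<in>K. X l (J l)) = X i (J i) * (\<Prod>l\<in>K - {i}. X l (J l))"
        using that fin by (subst prod.remove[of _ i]) auto
      ultimately show ?thesis by simp
    qed
    then show ?thesis unfolding inj_sum_def by (auto intro!: sum.cong)
  qed
  finally show ?thesis .
qed

lemma inj_sum_single: "finite R \<Longrightarrow> inj_sum {k} R X = (\<Sum>j\<in>R. X k j)"
  using inj_sum_insert_column[of "{}" R k X] by (simp add: injections_empty)

lemma inj_sum_pair:
  assumes "finite R" "k \<noteq> l" "(\<Sum>j\<in>R. X k j) = 0"
  shows "inj_sum {k, l} R X = - (\<Sum>j\<in>R. X k j * X l j)"
  using inj_sum_insert_zero_sum_column[of "{l}" R k X] assms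
  by (simp add: inj_sum_single mult.commute)

lemma inj_sum_triple:
  assumes "finite R" "k \<noteq> l" "k \<noteq> p" "l \<noteq> p"
    and "(\<Sum>j\<in>R. X k j) = 0" "(\<Sum>j\<in>R. X l j) = 0" "(\<Sum>j\<in>R. X p j) = 0"
  shows "inj_sum {k, l, p} R X = 2 * (\<Sum>j\<in>R. X k j * X l j * X p j)"
proof -
  have 1: "inj_sum {l, p} R (X(l := \<lambda>j. X l j * X k j)) = - (\<Sum>j\<in>R. X k j * X l j * X p j)"
    using inj_sum_pair[of R p l "X(l := \<lambda>j. X l j * X k j)"] assms
    by (simp add: insert_commute mult_ac)
  have 2: "inj_sum {l, p} R (X(p := \<lambda>j. X p j * X k j)) = - (\<Sum>j\<in>R. X k j * X l j * X p j)"
    using inj_sum_pair[of R l p "X(p := \<lambda>j. X p j * X k j)"] assms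
    by (simp add: mult_ac)
  show ?thesis using inj_sum_insert_zero_sum_column[of "{l, p}" R k X] assms
    by (simp add: 1 2)
qed

section \<open>Multilinear coefficients and the expansion of the permanent\<close>

definition multilinear_monomial :: "nat set \<Rightarrow> nat \<Rightarrow>\<^sub>0 nat" where
  "multilinear_monomial K = (\<Sum>k\<in>K. Poly_Mapping.single k 1)"

definition multilinear_coeff :: "nat set \<Rightarrow> cpoly \<Rightarrow> complex" where
  "multilinear_coeff K p = Poly_Mapping.lookup p (multilinear_monomial K)"

lemma lookup_multilinear_monomial:
  "finite K \<Longrightarrow> Poly_Mapping.lookup (multilinear_monomial K) i = (if i \<in> K then 1 else 0)"
  by (simp add: multilinear_monomial_def Poly_Mapping.lookup_sum Poly_Mapping.lookup_single when_def)

lemma multilinear_monomial_remove: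
  "finite K \<Longrightarrow> k \<in> K \<Longrightarrow>
    multilinear_monomial K = Poly_Mapping.single k 1 + multilinear_monomial (K - {k})"
  by (simp add: multilinear_monomial_def sum.remove)

lemma lookup_single_times:
  fixes s m :: "nat \<Rightarrow>\<^sub>0 nat" and p :: cpoly
  shows "Poly_Mapping.lookup (Poly_Mapping.single s c * p) m
    = c * (\<Sum>q. Poly_Mapping.lookup p q when m = s + q)"
proof -
  have "Poly_Mapping.lookup (Poly_Mapping.single s c * p) m
    = (\<Sum>l. (c * (\<Sum>q. Poly_Mapping.lookup p q when m = l + q)) when l = s)"
    unfolding lookup_mult
    by (intro Sum_any.cong) (simp add: Poly_Mapping.lookup_single when_def)
  then show ?thesis by simp
qed

lemma multilinear_coeff_single_times:
  assumes "finite K"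
  shows "multilinear_coeff K (Poly_Mapping.single (Poly_Mapping.single k 1) c * p)
    = (if k \<in> K then c * multilinear_coeff (K - {k}) p else 0)"
proof (cases "k \<in> K")
  case True
  then have "(\<Sum>q. Poly_Mapping.lookup p q when multilinear_monomial K = Poly_Mapping.single k 1 + q)
    = (\<Sum>q. Poly_Mapping.lookup p q when q = multilinear_monomial (K - {k}))"
    using multilinear_monomial_remove[OF assms True] by (intro Sum_any.cong) (auto simp: when_def)
  then show ?thesis using True by (simp add: multilinear_coeff_def lookup_single_times)
next
  case False
  have "multilinear_monomial K \<noteq> Poly_Mapping.single k 1 + q" for q
  proof
    assume "multilinear_monomial K = Poly_Mapping.single k 1 + q"
    then have "Poly_Mapping.lookup (multilinear_monomial K) k
      = Poly_Mapping.lookup (Poly_Mapping.single k 1 + q) k" by simp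
    then show False using False assms
      by (simp add: lookup_multilinear_monomial Poly_Mapping.lookup_add)
  qed
  then show ?thesis using False by (simp add: multilinear_coeff_def lookup_single_times)
qed

text \<open>
  In a monomial without squares the factor from the linear form is one of the indeterminates in \<open>K\<close>, and
  the cofactor has to supply the others.
\<close>

lemma multilinear_coeff_linear_form_times:
  assumes "K \<subseteq> {1..n}"
  shows "multilinear_coeff K (linear_form n c * p) = (\<Sum>k\<in>K. c k * multilinear_coeff (K - {k}) p)"
proof -
  have fin: "finite K" using assms finite_subset by auto
  have "multilinear_coeff K (linear_form n c * p)
    = (\<Sum>k=1..n. multilinear_coeff K (Poly_Mapping.single (Poly_Mapping.single k 1) (c k) * p))"
    by (simp add: linear_form_def sum_distrib_right multilinear_coeff_def Poly_Mapping.lookup_sum)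
  also have "\<dots> = (\<Sum>k=1..n. if k \<in> K then c k * multilinear_coeff (K - {k}) p else 0)"
    using fin multilinear_coeff_single_times by simp
  also have "\<dots> = (\<Sum>k\<in>K. c k * multilinear_coeff (K - {k}) p)"
    using assms by (intro sum.mono_neutral_cong_right) auto
  finally show ?thesis .
qed

lemma multilinear_coeff_one: "finite K \<Longrightarrow> multilinear_coeff K 1 = (if K = {} then 1 else 0)"
proof -
  assume fin: "finite K"
  have "multilinear_monomial K = 0 \<longleftrightarrow> K = {}"
    using lookup_multilinear_monomial[OF fin]
    by (metis all_not_in_conv lookup_zero multilinear_monomial_def sum.empty zero_neq_one)
  then show ?thesis by (auto simp: multilinear_coeff_def Poly_Mapping.lookup_one when_def)
qed

lemma multilinear_coeff_add:
  "multilinear_coeff K (p + q) = multilinear_coeff K p + multilinear_coeff K q"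
  by (simp add: multilinear_coeff_def Poly_Mapping.lookup_add)

text \<open>
  Choosing which rows contribute which indeterminates is choosing an injection: each indeterminate in
  \<open>L\<close> comes from one row, each row gives at most one, and the factor \<open>p\<close> supplies \<open>K - L\<close>.
\<close>

lemma multilinear_coeff_prod_times:
  assumes "finite R" "K \<subseteq> {1..n}"
  shows "multilinear_coeff K ((\<Prod>j\<in>R. 1 + linear_form n (c j)) * p)
    = (\<Sum>L\<in>Pow K. inj_sum L R (\<lambda>k j. c j k) * multilinear_coeff (K - L) p)"
  using assms
proof (induction R arbitrary: K p rule: finite_induct)
  case empty
  have "finite K" using empty finite_subset by auto
  have "inj_sum L {} (\<lambda>k j. c j k) = (if L = {} then 1 else 0)" for L
  proof (cases "L = {}")
    case False
    then have "injections L {} = {}" by (auto simp: injections_def)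
    then show ?thesis using False by (simp add: inj_sum_def)
  qed simp
  then have "(\<Sum>L\<in>Pow K. inj_sum L {} (\<lambda>k j. c j k) * multilinear_coeff (K - L) p)
    = (\<Sum>L\<in>{{}}. multilinear_coeff (K - L) p)"
    using \<open>finite K\<close> by (intro sum.mono_neutral_cong_right) auto
  then show ?case by simp
next
  case (insert r R)
  have fin: "finite K" using insert.prems finite_subset by auto
  let ?X = "\<lambda>k j. c j k" and ?q = "\<lambda>K. multilinear_coeff K p"
  let ?P = "\<Prod>j\<in>R. 1 + linear_form n (c j)"
  have "multilinear_coeff K ((\<Prod>j\<in>insert r R. 1 + linear_form n (c j)) * p)
    = multilinear_coeff K (?P * p) + multilinear_coeff K (linear_form n (c r) * (?P * p))"
    using insert.hyps by (simp add: algebra_simps multilinear_coeff_add)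
  also have "multilinear_coeff K (linear_form n (c r) * (?P * p))
    = (\<Sum>k\<in>K. c r k * (\<Sum>L\<in>Pow (K - {k}). inj_sum L R ?X * ?q (K - {k} - L)))"
  proof -
    have "multilinear_coeff (K - {k}) (?P * p) = (\<Sum>L\<in>Pow (K - {k}). inj_sum L R ?X * ?q (K - {k} - L))" for k
      using insert.prems by (intro insert.IH) auto
    then show ?thesis using insert.prems by (simp only: multilinear_coeff_linear_form_times)
  qed
  also have "\<dots> = (\<Sum>(k, L)\<in>(SIGMA k:K. Pow (K - {k})). c r k * (inj_sum L R ?X * ?q (K - {k} - L)))"
    using fin by (subst sum.Sigma[symmetric]) (auto simp: sum_distrib_left)
  also have "\<dots> = (\<Sum>(L, k)\<in>(SIGMA L:Pow K. L). c r k * (inj_sum (L - {k}) R ?X * ?q (K - L)))"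
  proof (rule sum.reindex_bij_witness[where i = "\<lambda>(L, k). (k, L - {k})" and j = "\<lambda>(k, L). (insert k L, k)"],
      goal_cases)
    case (5 a)
    obtain k L where a: "a = (k, L)" by force
    have "insert k L - {k} = L" "K - insert k L = K - {k} - L" using 5 unfolding a by auto
    then show ?case unfolding a by simp
  qed auto
  also have "\<dots> = (\<Sum>L\<in>Pow K. (\<Sum>k\<in>L. c r k * inj_sum (L - {k}) R ?X) * ?q (K - L))"
    using fin by (subst sum.Sigma[symmetric]) (auto simp: sum_distrib_right mult.assoc finite_subset)
  also have "multilinear_coeff K (?P * p) + \<dots>
    = (\<Sum>L\<in>Pow K. inj_sum L (insert r R) ?X * ?q (K - L))"
    unfolding insert.IH[OF insert.prems] sum.distrib[symmetric] using fin insert.hyps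
    by (intro sum.cong refl, subst inj_sum_insert_row) (auto simp: finite_subset algebra_simps)
  finally show ?case .
qed

lemma multilinear_coeff_linear_form_power:
  assumes "K \<subseteq> {1..n}"
  shows "multilinear_coeff K (linear_form n c ^ p) = (if card K = p then fact p * (\<Prod>k\<in>K. c k) else 0)"
  using assms
proof (induction p arbitrary: K)
  case 0
  then have "finite K" using finite_subset by auto
  then show ?case by (auto simp: multilinear_coeff_one)
next
  case (Suc p)
  have fin: "finite K" using Suc.prems finite_subset by auto
  have "multilinear_coeff K (linear_form n c ^ Suc p)
    = (\<Sum>k\<in>K. c k * (if card (K - {k}) = p then fact p * (\<Prod>k\<in>K - {k}. c k) else 0))"
  proof -
    have "multilinear_coeff (K - {k}) (linear_form n c ^ p)
      = (if card (K - {k}) = p then fact p * (\<Prod>k\<in>K - {k}. c k) else 0)" for k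
      using Suc.prems by (intro Suc.IH) auto
    then show ?thesis using Suc.prems by (simp only: power_Suc multilinear_coeff_linear_form_times)
  qed
  also have "\<dots> = (\<Sum>k\<in>K. if card K = Suc p then fact p * (\<Prod>k\<in>K. c k) else 0)"
  proof (rule sum.cong, goal_cases)
    case (2 k)
    then have "card K > 0" using fin by (auto simp: card_gt_0_iff)
    then show ?case using 2 fin by (auto simp: prod.remove)
  qed simp
  also have "\<dots> = (if card K = Suc p then fact (Suc p) * (\<Prod>k\<in>K. c k) else 0)"
    by (auto simp: algebra_simps)
  finally show ?case .
qed

lemma Per_eq_inj_sum: "Per N n Z = inj_sum {1..n} {1..N} (\<lambda>k j. Z j k)"
  by (simp add: Per_def inj_sum_def injections_def)

lemma G_eq_sum_inj_sum:
  assumes "m \<le> n" "n \<le> N"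
  shows "G N n Z m = fact (N - m) / fact N * (\<Sum>K | K \<subseteq> {1..n} \<and> card K = m.
    inj_sum K {1..N} (\<lambda>k j. centred N Z j k) * (\<Prod>k\<in>{1..n} - K. col_mean N Z k))"
proof -
  let ?I = "\<lambda>K. inj_sum K {1..N} (\<lambda>k j. centred N Z j k)"
  have *: "(if card ({1..n} - L) = n - m then fact (n - m) * (\<Prod>k\<in>{1..n} - L. col_mean N Z k) else 0)
    = (if card L = m then fact (n - m) * (\<Prod>k\<in>{1..n} - L. col_mean N Z k) else 0)" if "L \<subseteq> {1..n}" for L
  proof -
    have "card ({1..n} - L) = n - card L" "card L \<le> n"
      using that by (auto simp: card_Diff_subset finite_subset dest: card_mono[rotated])
    then show ?thesis using assms by auto
  qed
  have "Coeff n ((\<Prod>j=1..N. 1 + linear_form n (centred N Z j)) * linear_form n (col_mean N Z) ^ (n - m))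
    = (\<Sum>L\<in>Pow {1..n}. ?I L * multilinear_coeff ({1..n} - L) (linear_form n (col_mean N Z) ^ (n - m)))"
    using multilinear_coeff_prod_times[of "{1..N}" "{1..n}" n "centred N Z"]
    by (simp add: Coeff_def multilinear_coeff_def multilinear_monomial_def)
  also have "\<dots> = (\<Sum>L\<in>Pow {1..n}. if card L = m then fact (n - m) * (?I L * (\<Prod>k\<in>{1..n} - L. col_mean N Z k)) else 0)"
    by (intro sum.cong refl, subst multilinear_coeff_linear_form_power) (use * in auto)
  also have "\<dots> = (\<Sum>K | K \<subseteq> {1..n} \<and> card K = m. fact (n - m) * (?I K * (\<Prod>k\<in>{1..n} - K. col_mean N Z k)))"
    by (intro sum.mono_neutral_cong_right) auto
  finally show ?thesis by (simp add: G_def sum_distrib_left[symmetric])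
qed

text \<open>
  An injection on \<open>K\<close> extends to one more constant column in as many ways as there are free rows;
  the number of free rows drops by one with each column.
\<close>

lemma inj_sum_constant_columns:
  assumes fin: "finite K" "finite L" "finite R" and disj: "K \<inter> L = {}" and card: "card (K \<union> L) \<le> card R"
    and const: "\<And>k j. k \<in> L \<Longrightarrow> j \<in> R \<Longrightarrow> X k j = b k"
  shows "inj_sum (K \<union> L) R X
    = fact (card R - card K) / fact (card R - card (K \<union> L)) * inj_sum K R X * (\<Prod>k\<in>L. b k)"
  using fin(2) disj card const
proof (induction L rule: finite_induct)
  case empty
  then show ?case by simp
next
  case (insert l L)
  have KL: "finite (K \<union> L)" "l \<notin> K \<union> L" using insert fin by auto
  have c: "card (K \<union> insert l L) = Suc (card (K \<union> L))" using KL by simp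
  have le: "card (K \<union> L) < card R" using insert.prems c by simp
  have IH: "inj_sum (K \<union> L) R X
    = fact (card R - card K) / fact (card R - card (K \<union> L)) * inj_sum K R X * (\<Prod>k\<in>L. b k)"
    using insert.prems le by (intro insert.IH) auto
  have s: "(\<Sum>j\<in>R - J ` (K \<union> L). X l j) = of_nat (card R - card (K \<union> L)) * b l" if "J \<in> injections (K \<union> L) R" for J
  proof -
    have "(\<Sum>j\<in>R - J ` (K \<union> L). X l j) = (\<Sum>j\<in>R - J ` (K \<union> L). b l)"
      using insert.prems by (intro sum.cong) auto
    moreover have "J ` (K \<union> L) \<subseteq> R" "inj_on J (K \<union> L)" using that by (auto simp: injections_def)
    then have "card (R - J ` (K \<union> L)) = card R - card (K \<union> L)"
      using KL by (subst card_Diff_subset) (auto simp: card_image)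
    ultimately show ?thesis by simp
  qed
  have "inj_sum (K \<union> insert l L) R X = of_nat (card R - card (K \<union> L)) * b l * inj_sum (K \<union> L) R X"
    using inj_sum_insert_column[OF KL(1) fin(3) KL(2), of X] s
    by (simp add: inj_sum_def sum_distrib_left sum_distrib_right mult_ac)
  moreover have "card R - card (K \<union> L) = Suc (card R - card (K \<union> insert l L))" using c le by simp
  then have "fact (card R - card (K \<union> L))
    = (of_nat (card R - card (K \<union> L)) * fact (card R - card (K \<union> insert l L)) :: complex)"
    by (metis fact_Suc of_nat_mult)
  moreover have "of_nat (card R - card (K \<union> L)) \<noteq> (0 :: complex)" using le by simp
  ultimately show ?case unfolding IH using insert.hyps by (simp add: field_simps)
qed

lemma inj_sum_add:
  assumes fin: "finite A" "finite R" and card: "card A \<le> card R"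
  shows "inj_sum A R (\<lambda>k j. X k j + b k)
    = (\<Sum>K\<in>Pow A. fact (card R - card K) / fact (card R - card A) * (inj_sum K R X * (\<Prod>k\<in>A - K. b k)))"
proof -
  have "inj_sum A R (\<lambda>k j. X k j + b k)
    = (\<Sum>J\<in>injections A R. \<Sum>K\<in>Pow A. (\<Prod>k\<in>K. X k (J k)) * (\<Prod>k\<in>A - K. b k))"
    by (simp add: inj_sum_def prod_add[OF fin(1)])
  also have "\<dots> = (\<Sum>K\<in>Pow A. \<Sum>J\<in>injections A R. (\<Prod>k\<in>K. X k (J k)) * (\<Prod>k\<in>A - K. b k))"
    by (rule sum.swap)
  also have "\<dots> = (\<Sum>K\<in>Pow A. inj_sum A R (\<lambda>k j. if k \<in> K then X k j else b k))"
    unfolding inj_sum_def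
  proof (intro sum.cong refl, goal_cases)
    case (1 K J)
    then have "(\<Prod>k\<in>A. if k \<in> K then X k (J k) else b k)
      = (\<Prod>k\<in>K. if k \<in> K then X k (J k) else b k) * (\<Prod>k\<in>A - K. if k \<in> K then X k (J k) else b k)"
      using fin by (subst prod.subset_diff[of K A]) (auto simp: mult.commute)
    then show ?case by simp
  qed
  also have "\<dots> = (\<Sum>K\<in>Pow A. fact (card R - card K) / fact (card R - card A) * (inj_sum K R X * (\<Prod>k\<in>A - K. b k)))"
  proof (intro sum.cong refl, goal_cases)
    case (1 K)
    then have [simp]: "K \<union> (A - K) = A" and "finite K" using fin by (auto intro: finite_subset)
    moreover have "inj_sum K R (\<lambda>k j. if k \<in> K then X k j else b k) = inj_sum K R X"
      by (rule inj_sum_cong) auto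
    ultimately show ?case
      using inj_sum_constant_columns[of K "A - K" R "\<lambda>k j. if k \<in> K then X k j else b k" b] fin card by simp
  qed
  finally show ?thesis .
qed

text \<open>
  Each column of \<open>Z\<close> is its centred column plus a constant one; sorting the expansion by the number of
  centred columns gives the terms \<open>G N n Z m\<close>.
\<close>

lemma Per_eq_sum_G:
  assumes "n \<le> N"
  shows "fact (N - n) / fact N * Per N n Z = (\<Sum>m=0..n. G N n Z m)"
proof -
  let ?f = "\<lambda>K. fact (N - card K) / fact N * (inj_sum K {1..N} (\<lambda>k j. centred N Z j k)
    * (\<Prod>k\<in>{1..n} - K. col_mean N Z k))"
  have "Per N n Z = inj_sum {1..n} {1..N} (\<lambda>k j. centred N Z j k + col_mean N Z k)"
    by (simp add: Per_eq_inj_sum centred_def)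
  then have "fact (N - n) / fact N * Per N n Z = (\<Sum>K\<in>Pow {1..n}. ?f K)"
    using assms by (subst (asm) inj_sum_add) (auto simp: sum_distrib_left mult_ac)
  also have "\<dots> = (\<Sum>m\<in>{0..n}. \<Sum>K\<in>{K \<in> Pow {1..n}. card K = m}. ?f K)"
    by (rule sum.group[symmetric]) (auto dest: card_mono[rotated])
  also have "\<dots> = (\<Sum>m=0..n. G N n Z m)"
    using assms by (intro sum.cong refl) (auto simp: G_eq_sum_inj_sum sum_distrib_left)
  finally show ?thesis .
qed

section \<open>Symmetric multilinear forms attain their norm on the diagonal\<close>

text \<open>
  The real inner product of \<open>\<complex>\<^sup>R\<close>.  Vectors are functions on all of \<open>nat\<close>, since the dimension is not fixed by
  a type; real scalars suffice for the theorem of Banach below.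
\<close>

definition rinner :: "nat set \<Rightarrow> (nat \<Rightarrow> complex) \<Rightarrow> (nat \<Rightarrow> complex) \<Rightarrow> real" where
  "rinner R f g = (\<Sum>j\<in>R. f j \<bullet> g j)"

abbreviation sqnorm :: "nat set \<Rightarrow> (nat \<Rightarrow> complex) \<Rightarrow> real" where
  "sqnorm R f \<equiv> rinner R f f"

lemma sqnorm_eq: "sqnorm R f = (\<Sum>j\<in>R. (cmod (f j))\<^sup>2)"
  by (simp add: rinner_def power2_norm_eq_inner)

lemma sqnorm_nonneg: "sqnorm R f \<ge> 0"
  by (simp add: rinner_def sum_nonneg)

lemma rinner_commute: "rinner R f g = rinner R g f"
  by (simp add: rinner_def inner_commute)

lemma rinner_add_left: "rinner R (\<lambda>j. f j + g j) h = rinner R f h + rinner R g h"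
  by (simp add: rinner_def inner_add_left sum.distrib)

lemma rinner_add_right: "rinner R h (\<lambda>j. f j + g j) = rinner R h f + rinner R h g"
  by (simp add: rinner_def inner_add_right sum.distrib)

lemma rinner_scale_left: "rinner R (\<lambda>j. c *\<^sub>R f j) h = c * rinner R f h"
  by (simp add: rinner_def sum_distrib_left)

lemma rinner_scale_right: "rinner R h (\<lambda>j. c *\<^sub>R f j) = c * rinner R h f"
  by (simp add: rinner_def sum_distrib_left)

lemmas rinner_simps = rinner_add_left rinner_add_right rinner_scale_left rinner_scale_right

lemma continuous_on_entry: "continuous_on S (\<lambda>X :: nat \<Rightarrow> nat \<Rightarrow> complex. X i j)"
  by (intro continuous_on_product_then_coordinatewise[of S "\<lambda>X. X i"]
      continuous_on_product_then_coordinatewise[of S "\<lambda>X. X"] continuous_on_id)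

text \<open>
  Tychonoff's theorem in the product topology, applied once for each index.
\<close>

lemma compact_bounded_arrays: "compact {X :: nat \<Rightarrow> nat \<Rightarrow> complex. \<forall>i j. cmod (X i j) \<le> 1}"
proof -
  have PiE: "compact (PiE UNIV (\<lambda>_::nat. S))" if "compact S" for S :: "'b::topological_space set"
    using that compactin_PiE[of "\<lambda>_::nat. euclidean :: 'b topology" UNIV "\<lambda>_. S"]
    by (simp add: euclidean_product_topology compactin_euclidean_iff)
  have "compact (PiE UNIV (\<lambda>_::nat. PiE UNIV (\<lambda>_::nat. cball (0::complex) 1)))"
    by (intro PiE) simp
  moreover have "PiE UNIV (\<lambda>_::nat. PiE UNIV (\<lambda>_::nat. cball (0::complex) 1)) = {X. \<forall>i j. cmod (X i j) \<le> 1}"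
    by (simp add: PiE_UNIV_domain Pi_def)
  ultimately show ?thesis by simp
qed

text \<open>
  Banach's theorem on symmetric multilinear forms, for a finite-dimensional space \<open>V\<close> of vectors on \<open>R\<close>.
  Among the tuples in the unit ball where \<open>|L|\<close> attains its maximum, which may be assumed positive,
  take one whose sum is longest.  If two arguments \<open>x\<close> and \<open>y\<close> differed, polarisation would force them
  to be unit vectors and show that replacing both by the normalised \<open>x + y\<close> keeps the maximum.
  Replacing an argument by its negative keeps \<open>|L|\<close> as well, so \<open>x\<close> and \<open>y\<close> have inner product at least \<open>1\<close>
  with the sum.  Hence the first replacement makes the sum longer, a contradiction.
\<close>

theorem symmetric_multilinear_bound:
  fixes L :: "(nat \<Rightarrow> nat \<Rightarrow> complex) \<Rightarrow> complex"
  assumes fin: "finite I" "finite R"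
    and V: "closed V" "(\<lambda>_. 0) \<in> V"
      "\<And>f g. f \<in> V \<Longrightarrow> g \<in> V \<Longrightarrow> (\<lambda>j. f j + g j) \<in> V"
      "\<And>f c. f \<in> V \<Longrightarrow> (\<lambda>j. c *\<^sub>R f j) \<in> V"
      "\<And>f j. f \<in> V \<Longrightarrow> j \<notin> R \<Longrightarrow> f j = 0"
    and cont: "continuous_on UNIV L"
    and sym: "\<And>X i k f g. i \<in> I \<Longrightarrow> k \<in> I \<Longrightarrow> i \<noteq> k \<Longrightarrow> L (X(i := f, k := g)) = L (X(i := g, k := f))"
    and add: "\<And>X i f g. i \<in> I \<Longrightarrow> L (X(i := \<lambda>j. f j + g j)) = L (X(i := f)) + L (X(i := g))"
    and scale: "\<And>X i f c. i \<in> I \<Longrightarrow> L (X(i := \<lambda>j. c *\<^sub>R f j)) = c *\<^sub>R L (X(i := f))"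
    and diag: "\<And>f. f \<in> V \<Longrightarrow> sqnorm R f \<le> 1 \<Longrightarrow> cmod (L (\<lambda>i. if i \<in> I then f else (\<lambda>_. 0))) \<le> M"
    and X: "\<And>i. i \<in> I \<Longrightarrow> X i \<in> V" "\<And>i. i \<in> I \<Longrightarrow> sqnorm R (X i) \<le> 1"
      "\<And>i. i \<notin> I \<Longrightarrow> X i = (\<lambda>_. 0)"
  shows "cmod (L X) \<le> M"
proof -
  define T where "T = {X. (\<forall>i\<in>I. X i \<in> V \<and> sqnorm R (X i) \<le> 1) \<and> (\<forall>i. i \<notin> I \<longrightarrow> X i = (\<lambda>_. 0))}"
  have "T \<subseteq> {X. \<forall>i j. cmod (X i j) \<le> 1}"
  proof safe
    fix X i j assume T: "X \<in> T"
    show "cmod (X i j) \<le> 1"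
    proof (cases "i \<in> I \<and> j \<in> R")
      case True
      then have "(cmod (X i j))\<^sup>2 \<le> sqnorm R (X i)"
        using fin unfolding sqnorm_eq by (intro member_le_sum) auto
      also have "\<dots> \<le> 1\<^sup>2" using True T by (simp add: T_def)
      finally show ?thesis by (rule power2_le_imp_le) simp
    next
      case False
      then have "X i j = 0" using T V(5)[of "X i" j] by (cases "i \<in> I") (auto simp: T_def)
      then show ?thesis by simp
    qed
  qed
  moreover have "closed T"
  proof -
    have "T = (\<Inter>i\<in>I. (\<lambda>X. X i) -` V \<inter> {X. sqnorm R (X i) \<le> 1}) \<inter> (\<Inter>i\<in>-I. \<Inter>j. {X. X i j = 0})"
      unfolding T_def by (auto simp: fun_eq_iff)
    moreover have "closed ((\<lambda>X. X i) -` V)" for i :: nat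
      using V(1) by (rule closed_vimage) simp
    moreover have "closed {X :: nat \<Rightarrow> nat \<Rightarrow> complex. sqnorm R (X i) \<le> 1}" for i
      unfolding sqnorm_eq by (intro closed_Collect_le continuous_intros continuous_on_entry)
    moreover have "closed {X :: nat \<Rightarrow> nat \<Rightarrow> complex. X i j = 0}" for i j
      by (intro closed_Collect_eq continuous_intros continuous_on_entry)
    ultimately show ?thesis by (auto intro!: closed_Int closed_INT)
  qed
  ultimately have "compact T"
    using compact_Int_closed[OF compact_bounded_arrays, of T] by (simp add: Int_absorb1)
  moreover have XT: "X \<in> T" using X by (simp add: T_def)
  moreover have cont_norm: "continuous_on S (\<lambda>X. cmod (L X))" for S
    using continuous_on_subset[OF cont] by (intro continuous_intros) auto
  ultimately obtain X0 where X0: "X0 \<in> T" "\<And>Y. Y \<in> T \<Longrightarrow> cmod (L Y) \<le> cmod (L X0)"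
    using continuous_attains_sup[of T "\<lambda>X. cmod (L X)"] by auto
  define m where "m = cmod (L X0)"
  have le_m: "cmod (L Y) \<le> m" if "Y \<in> T" for Y using X0 that m_def by simp
  define T1 where "T1 = {Y \<in> T. cmod (L Y) = m}"
  define total :: "(nat \<Rightarrow> nat \<Rightarrow> complex) \<Rightarrow> nat \<Rightarrow> complex" where "total Y = (\<lambda>j. \<Sum>i\<in>I. Y i j)" for Y
  have "T1 = T \<inter> {Y. cmod (L Y) = m}" by (auto simp: T1_def)
  then have "compact T1"
    using \<open>compact T\<close> closed_Collect_eq[OF cont_norm[of UNIV] continuous_on_const, of m]
    by (simp add: compact_Int_closed)
  moreover have "X0 \<in> T1" using X0 m_def by (simp add: T1_def)
  moreover have "continuous_on T1 (\<lambda>Y. sqnorm R (total Y))"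
    unfolding sqnorm_eq total_def by (intro continuous_intros continuous_on_entry)
  ultimately obtain Y where Y: "Y \<in> T1" and Ymax: "\<And>Y'. Y' \<in> T1 \<Longrightarrow> sqnorm R (total Y') \<le> sqnorm R (total Y)"
    using continuous_attains_sup[of T1 "\<lambda>Y. sqnorm R (total Y)"] by auto
  have YT: "Y \<in> T" and LY: "cmod (L Y) = m" using Y by (auto simp: T1_def)
  have "m \<le> M"
  proof (cases "m = 0")
    case True
    have "cmod (L (\<lambda>i. if i \<in> I then (\<lambda>_. 0) else (\<lambda>_. 0))) \<le> M"
      using V(2) by (intro diag) (auto simp: rinner_def)
    then show ?thesis using True norm_ge_zero order_trans by blast
  next
    case False
    then have m: "m > 0" using m_def by simp
    have upd: "Y(i := f, k := g) \<in> T"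
      if "i \<in> I" "k \<in> I" "f \<in> V" "g \<in> V" "sqnorm R f \<le> 1" "sqnorm R g \<le> 1" for i k f g
      using YT that by (auto simp: T_def)
    have diag2: "cmod (L (Y(i := f, k := f))) \<le> m * sqnorm R f" if ik: "i \<in> I" "k \<in> I" "i \<noteq> k" and f: "f \<in> V" for i k f
    proof (cases "sqnorm R f = 0")
      case True
      then have "f j = 0" for j
        using V(5)[OF f] fin by (cases "j \<in> R") (auto simp: sqnorm_eq sum_nonneg_eq_0_iff)
      then have "f = (\<lambda>j. 0 *\<^sub>R f j)" by auto
      then have "L (Y(i := f, k := f)) = 0 *\<^sub>R L (Y(i := f, k := f))"
        using scale[of k "Y(i := f)" 0 f] ik by simp
      then show ?thesis using True by simp
    next
      case False
      define r where "r = sqrt (sqnorm R f)"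
      have r: "r > 0" "r\<^sup>2 = sqnorm R f" using False sqnorm_nonneg[of R f] by (auto simp: r_def less_le)
      define g where "g = (\<lambda>j. (1 / r) *\<^sub>R f j)"
      have g: "g \<in> V" using V(4)[OF f] by (simp add: g_def)
      have "sqnorm R g = (1 / r) * ((1 / r) * sqnorm R f)" by (simp add: g_def rinner_simps)
      then have g1: "sqnorm R g = 1" using r by (simp add: power2_eq_square flip: r(2))
      have fg: "f = (\<lambda>j. r *\<^sub>R g j)" using r by (auto simp: g_def)
      have 1: "L (Y(i := f, k := f)) = r *\<^sub>R L (Y(i := f, k := g))"
        using scale[of k "Y(i := f)" r g] ik by (simp flip: fg)
      have 2: "L (Y(i := f, k := g)) = r *\<^sub>R L (Y(i := g, k := g))"
        using scale[of i "Y(k := g)" r g] ik by (simp add: fun_upd_twist flip: fg)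
      have "cmod (L (Y(i := f, k := f))) = r\<^sup>2 * cmod (L (Y(i := g, k := g)))"
        unfolding 1 2 using r(1) by (simp add: power2_eq_square)
      also have "\<dots> \<le> r\<^sup>2 * m" using ik g g1 upd by (intro mult_left_mono le_m) auto
      finally show ?thesis by (simp add: r mult.commute)
    qed
    have "Y i = Y k" if ik: "i \<in> I" "k \<in> I" for i k
    proof (rule ccontr)
      assume ne: "Y i \<noteq> Y k"
      then have "i \<noteq> k" by auto
      define x y where "x = Y i" and "y = Y k"
      have xy: "x \<in> V" "y \<in> V" "sqnorm R x \<le> 1" "sqnorm R y \<le> 1"
        using YT ik by (auto simp: T_def x_def y_def)
      define w z where "w = (\<lambda>j. x j + y j)" and "z = (\<lambda>j. x j + (-1) *\<^sub>R y j)"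
      have my: "(\<lambda>j. (-1) *\<^sub>R y j) \<in> V" by (rule V(4)[OF xy(2)])
      have wz: "w \<in> V" "z \<in> V" using V(3)[OF xy(1,2)] V(3)[OF xy(1) my] by (auto simp: w_def z_def)
      define b where "b f g = L (Y(i := f, k := g))" for f g
      have b_add: "b f (\<lambda>j. g j + h j) = b f g + b f h" "b (\<lambda>j. g j + h j) f = b g f + b h f" for f g h
        using add[of k "Y(i := f)" g h] add[of i "Y(k := f)" g h] ik \<open>i \<noteq> k\<close>
        by (simp_all add: b_def fun_upd_twist)
      have b_scale: "b f (\<lambda>j. c *\<^sub>R g j) = c *\<^sub>R b f g" "b (\<lambda>j. c *\<^sub>R g j) f = c *\<^sub>R b g f" for f g c
        using scale[of k "Y(i := f)" c g] scale[of i "Y(k := f)" c g] ik \<open>i \<noteq> k\<close>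
        by (simp_all add: b_def fun_upd_twist)
      have b_sym: "b f g = b g f" for f g using sym ik \<open>i \<noteq> k\<close> by (simp add: b_def)
      have bxy: "b x y = L Y" by (simp add: b_def x_def y_def)
      \<comment> \<open>Polarisation.  By maximality and the parallelogram law the right side of the resulting inequality
         is at most its left side, so equality holds everywhere: \<open>x\<close> and \<open>y\<close> are unit vectors, and \<open>w\<close> in both
         slots is again extremal.\<close>
      have "b w w - b z z = 4 * L Y"
        unfolding w_def z_def b_add b_scale b_sym[of y x] bxy by simp
      then have "4 * m \<le> cmod (b w w) + cmod (b z z)"
        using norm_triangle_ineq4[of "b w w" "b z z"] by (simp add: LY norm_mult)
      moreover have "cmod (b z z) \<le> m * sqnorm R z" "cmod (b w w) \<le> m * sqnorm R w"
        using diag2 ik \<open>i \<noteq> k\<close> wz by (auto simp: b_def)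
      moreover have para: "sqnorm R w + sqnorm R z = 2 * (sqnorm R x + sqnorm R y)"
        unfolding w_def z_def rinner_simps by (simp add: rinner_commute[of R y x])
      moreover have "m * sqnorm R w + m * sqnorm R z = m * (2 * (sqnorm R x + sqnorm R y))"
        unfolding para[symmetric] by (rule distrib_left[symmetric])
      moreover have "m * (2 * (sqnorm R x + sqnorm R y)) \<le> m * 4"
        using xy m by (intro mult_left_mono) auto
      ultimately have eqs: "cmod (b w w) = m * sqnorm R w" "m * (2 * (sqnorm R x + sqnorm R y)) = m * 4"
        by linarith+
      then have unit: "sqnorm R x = 1" "sqnorm R y = 1" using m xy by auto
      define s where "s = total Y"
      have flip: "rinner R s (Y l) \<ge> sqnorm R (Y l)" if l: "l \<in> I" for l
      proof -
        let ?f = "\<lambda>j. (-1) *\<^sub>R Y l j"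
        have "sqnorm R ?f = sqnorm R (Y l)" by (simp only: rinner_simps)
        moreover have "?f \<in> V" using YT l by (intro V(4)) (auto simp: T_def)
        ultimately have "Y(l := ?f) \<in> T" using YT l by (auto simp: T_def)
        moreover have "L (Y(l := ?f)) = (-1) *\<^sub>R L (Y(l := Y l))" by (rule scale[OF l])
        then have "cmod (L (Y(l := ?f))) = m" by (simp add: LY)
        ultimately have "sqnorm R (total (Y(l := ?f))) \<le> sqnorm R s"
          unfolding s_def by (intro Ymax) (simp add: T1_def)
        moreover have "total (Y(l := ?f)) = (\<lambda>j. s j + (-2) *\<^sub>R Y l j)"
          unfolding total_def s_def using l fin by (auto simp: sum.remove fun_eq_iff scaleR_conv_of_real)
        ultimately have "sqnorm R (\<lambda>j. s j + (-2) *\<^sub>R Y l j) \<le> sqnorm R s" by simp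
        then show ?thesis unfolding rinner_simps by (simp add: rinner_commute[of R "Y l" s])
      qed
      have sw: "rinner R s w \<ge> 2"
        using flip[OF ik(1)] flip[OF ik(2)] unit by (simp add: w_def rinner_simps flip: x_def y_def)
      define q where "q = sqnorm R w"
      \<comment> \<open>The sum changes by a multiple \<open>2 / r - 1\<close> of \<open>w\<close>, where \<open>r\<close> is the length of \<open>w\<close>; the multiple is
         positive because \<open>x \<noteq> y\<close> forces \<open>r < 2\<close>.\<close>
      have "sqnorm R z \<noteq> 0"
      proof
        assume "sqnorm R z = 0"
        then have "z j = 0" for j
          using V(5)[OF wz(2)] fin by (cases "j \<in> R") (auto simp: sqnorm_eq sum_nonneg_eq_0_iff)
        then have "x = y" by (auto simp: z_def fun_eq_iff)
        then show False using ne by (simp add: x_def y_def)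
      qed
      then have q4: "q < 4" using para unit sqnorm_nonneg[of R z] by (simp add: q_def)
      have "q \<noteq> 0"
      proof
        assume "q = 0"
        then have "w j = 0" if "j \<in> R" for j
          using that fin by (auto simp: q_def sqnorm_eq sum_nonneg_eq_0_iff)
        then have "rinner R s w = 0" by (simp add: rinner_def)
        then show False using sw by simp
      qed
      then have q0: "q > 0" using sqnorm_nonneg[of R w] by (simp add: q_def)
      define r where "r = sqrt q"
      have r: "r > 0" "r < 2" "r\<^sup>2 = q" using q0 q4 real_sqrt_less_mono[OF q4] by (auto simp: r_def)
      define u where "u = (\<lambda>j. (1 / r) *\<^sub>R w j)"
      have "sqnorm R u = (1 / r) * ((1 / r) * r\<^sup>2)" by (simp add: u_def rinner_simps r q_def)
      then have u: "u \<in> V" "sqnorm R u = 1" using V(4)[OF wz(1)] r by (auto simp: u_def power2_eq_square)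
      have "b u u = (1 / r) *\<^sub>R ((1 / r) *\<^sub>R b w w)" unfolding u_def b_scale by simp
      then have "cmod (b u u) = (1 / r) * ((1 / r) * (m * r\<^sup>2))" using eqs r by (simp add: q_def)
      then have "cmod (b u u) = m" using r by (simp add: power2_eq_square)
      then have "Y(i := u, k := u) \<in> T1" using upd ik u by (simp add: T1_def b_def)
      then have "sqnorm R (total (Y(i := u, k := u))) \<le> sqnorm R s" unfolding s_def by (rule Ymax)
      moreover have "total (Y(i := u, k := u)) = (\<lambda>j. s j + (2 / r - 1) *\<^sub>R w j)"
      proof
        fix j
        have "(\<Sum>l\<in>I. Z l j) = Z i j + Z k j + (\<Sum>l\<in>I - {i} - {k}. Z l j)" for Z :: "nat \<Rightarrow> nat \<Rightarrow> complex"
          using ik \<open>i \<noteq> k\<close> fin sum.remove[of I i "\<lambda>l. Z l j"] sum.remove[of "I - {i}" k "\<lambda>l. Z l j"] by simp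
        from this[of Y] this[of "Y(i := u, k := u)"] have
          "total (Y(i := u, k := u)) j = s j - w j + 2 * u j"
          using \<open>i \<noteq> k\<close> by (simp add: total_def s_def w_def x_def y_def)
        then show "total (Y(i := u, k := u)) j = s j + (2 / r - 1) *\<^sub>R w j"
          by (simp add: u_def algebra_simps scaleR_conv_of_real)
      qed
      ultimately have "2 * ((2 / r - 1) * rinner R s w) + (2 / r - 1)\<^sup>2 * q \<le> 0"
        by (simp add: rinner_simps rinner_commute[of R w s] q_def power2_eq_square mult_ac)
      moreover have "2 / r - 1 > 0" using r by simp
      then have "(2 / r - 1) * rinner R s w > 0" "(2 / r - 1)\<^sup>2 * q \<ge> 0" using sw q0 by auto
      ultimately show False by linarith
    qed
    note const = this
    show ?thesis
    proof (cases "I = {}")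
      case True
      then have "Y = (\<lambda>i. if i \<in> I then (\<lambda>_. 0) else (\<lambda>_. 0))" using YT by (auto simp: T_def)
      moreover have "cmod (L (\<lambda>i. if i \<in> I then (\<lambda>_. 0) else (\<lambda>_. 0))) \<le> M"
        using V(2) by (intro diag) (auto simp: rinner_def)
      ultimately show ?thesis using LY by simp
    next
      case False
      then obtain i where i: "i \<in> I" by auto
      have "Y = (\<lambda>k. if k \<in> I then Y i else (\<lambda>_. 0))" using const[OF _ i] YT by (auto simp: T_def)
      moreover have "cmod (L (\<lambda>k. if k \<in> I then Y i else (\<lambda>_. 0))) \<le> M"
        using YT i by (intro diag) (auto simp: T_def)
      ultimately show ?thesis using LY by simp
    qed
  qed
  then show ?thesis using le_m[OF XT] by simp
qed

section \<open>Elementary symmetric sums\<close>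

definition esym :: "nat \<Rightarrow> 'b set \<Rightarrow> ('b \<Rightarrow> 'a::comm_semiring_1) \<Rightarrow> 'a" where
  "esym m A f = (\<Sum>T | T \<subseteq> A \<and> card T = m. \<Prod>i\<in>T. f i)"

lemma esym_0: "finite A \<Longrightarrow> esym 0 A f = 1"
proof -
  assume "finite A"
  then have "{T. T \<subseteq> A \<and> card T = 0} = {{}}" by (auto dest: finite_subset)
  then show ?thesis by (simp add: esym_def)
qed

lemma esym_Suc_empty: "esym (Suc m) {} f = 0"
proof -
  have "{T. T \<subseteq> {} \<and> card T = Suc m} = ({} :: 'b set set)" by auto
  then show ?thesis unfolding esym_def by (metis sum.empty)
qed

lemma esym_Suc_insert:
  assumes "finite A" "a \<notin> A"
  shows "esym (Suc m) (insert a A) f = esym (Suc m) A f + f a * esym m A f"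
proof -
  let ?S = "{T. T \<subseteq> A \<and> card T = m}"
  have eq: "{T. T \<subseteq> insert a A \<and> card T = Suc m} = {T. T \<subseteq> A \<and> card T = Suc m} \<union> insert a ` ?S"
  proof (intro equalityI subsetI)
    fix T assume T: "T \<in> {T. T \<subseteq> insert a A \<and> card T = Suc m}"
    show "T \<in> {T. T \<subseteq> A \<and> card T = Suc m} \<union> insert a ` ?S"
    proof (cases "a \<in> T")
      case True
      then have "T = insert a (T - {a})" "card (T - {a}) = m" using T assms by (auto simp: finite_subset)
      then show ?thesis using T by blast
    qed (use T in auto)
  qed (use assms in \<open>auto simp: card_insert_if finite_subset\<close>)
  have inj: "inj_on (insert a) ?S" using assms by (intro inj_onI) (metis (mono_tags) insert_ident mem_Collect_eq subsetD)
  have "esym (Suc m) (insert a A) f = esym (Suc m) A f + (\<Sum>T\<in>insert a ` ?S. \<Prod>i\<in>T. f i)"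
    unfolding esym_def eq using assms by (intro sum.union_disjoint) auto
  also have "(\<Sum>T\<in>insert a ` ?S. \<Prod>i\<in>T. f i) = (\<Sum>T\<in>?S. f a * (\<Prod>i\<in>T. f i))"
    unfolding sum.reindex[OF inj] o_def
    using assms by (intro sum.cong refl prod.insert) (auto dest: finite_subset)
  finally show ?thesis by (simp add: esym_def sum_distrib_left)
qed

text \<open>
  Every set of \<open>card K\<close> rows is the image of \<open>fact (card K)\<close> injections; the induction compares the row
  recursion with the recursion of \<open>esym\<close>.
\<close>

lemma inj_sum_equal_columns:
  assumes "finite K" "finite R"
  shows "inj_sum K R (\<lambda>_. f) = fact (card K) * esym (card K) R f"
  using assms(2,1)
proof (induction R arbitrary: K rule: finite_induct)
  case empty
  show ?case
  proof (cases "K = {}")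
    case False
    then have "injections K {} = {}" by (auto simp: injections_def)
    moreover obtain m where "card K = Suc m" using False empty by (metis card_eq_0_iff not0_implies_Suc)
    ultimately show ?thesis by (simp add: inj_sum_def esym_Suc_empty)
  qed (simp add: esym_0)
next
  case (insert r R)
  show ?case
  proof (cases "K = {}")
    case False
    then obtain m where m: "card K = Suc m" using insert.prems by (metis card_eq_0_iff not0_implies_Suc)
    have "inj_sum K (insert r R) (\<lambda>_. f) = inj_sum K R (\<lambda>_. f) + (\<Sum>k\<in>K. f r * inj_sum (K - {k}) R (\<lambda>_. f))"
      using insert by (intro inj_sum_insert_row)
    also have "(\<Sum>k\<in>K. f r * inj_sum (K - {k}) R (\<lambda>_. f)) = (\<Sum>k\<in>K. f r * (fact m * esym m R f))"
      using insert m by (intro sum.cong refl) (simp add: insert.IH)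
    finally show ?thesis using insert m
      by (simp add: insert.IH esym_Suc_insert algebra_simps)
  qed (use insert in \<open>simp add: esym_0\<close>)
qed

lemma prod_add_const_mult:
  fixes f :: "'b \<Rightarrow> 'a::comm_semiring_1"
  assumes "finite A"
  shows "(\<Prod>i\<in>A. z * f i + a) = (\<Sum>m\<le>card A. z ^ m * a ^ (card A - m) * esym m A f)"
proof -
  have "(\<Prod>i\<in>A. z * f i + a) = (\<Sum>T\<in>Pow A. z ^ card T * a ^ (card A - card T) * (\<Prod>i\<in>T. f i))"
    unfolding prod_add[OF assms]
    by (intro sum.cong refl) (use assms in \<open>auto simp: prod.distrib card_Diff_subset finite_subset mult_ac\<close>)
  also have "\<dots> = (\<Sum>m\<le>card A. \<Sum>T\<in>{T \<in> Pow A. card T = m}. z ^ card T * a ^ (card A - card T) * (\<Prod>i\<in>T. f i))"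
    using assms by (intro sum.group[symmetric]) (auto intro: card_mono)
  also have "\<dots> = (\<Sum>m\<le>card A. z ^ m * a ^ (card A - m) * esym m A f)"
    by (intro sum.cong refl) (auto simp: esym_def sum_distrib_left)
  finally show ?thesis .
qed

text \<open>
  The inequality of the arithmetic and geometric means, from \<open>x \<le> exp (x - 1)\<close>.
\<close>

lemma prod_le_1_of_sum_le_card:
  fixes x :: "'b \<Rightarrow> real"
  assumes "finite A" "\<And>i. i \<in> A \<Longrightarrow> x i \<ge> 0" "(\<Sum>i\<in>A. x i) \<le> card A"
  shows "(\<Prod>i\<in>A. x i) \<le> 1"
proof -
  have "(\<Prod>i\<in>A. x i) \<le> (\<Prod>i\<in>A. exp (x i - 1))"
    using assms exp_ge_add_one_self by (intro prod_mono) (smt (verit))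
  also have "\<dots> = exp ((\<Sum>i\<in>A. x i) - card A)"
    using assms(1) by (simp add: exp_sum sum_subtractf flip: exp_sum)
  also have "\<dots> \<le> 1" using assms(3) by simp
  finally show ?thesis .
qed

text \<open>
  Convexity.  The form of Bernoulli's inequality divides by \<open>y\<close>; here \<open>y\<close> may vanish, as the mean of the earlier
  numbers can do in the induction for \<open>maclaurin_inequality\<close>.
\<close>

lemma power_above_tangent:
  fixes y z :: real
  assumes "y \<ge> 0" "z \<ge> 0"
  shows "y ^ Suc p + real (Suc p) * y ^ p * (z - y) \<le> z ^ Suc p"
proof (induction p)
  case 0
  then show ?case by simp
next
  case (Suc p)
  have "y ^ Suc (Suc p) + real (Suc (Suc p)) * y ^ Suc p * (z - y) + real (Suc p) * y ^ p * (z - y)\<^sup>2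
      = z * (y ^ Suc p + real (Suc p) * y ^ p * (z - y))"
    by (simp add: algebra_simps power2_eq_square)
  also have "\<dots> \<le> z * z ^ Suc p" using Suc assms by (intro mult_left_mono) auto
  finally have "y ^ Suc (Suc p) + real (Suc (Suc p)) * y ^ Suc p * (z - y) + real (Suc p) * y ^ p * (z - y)\<^sup>2
    \<le> z ^ Suc (Suc p)" by simp
  moreover have "real (Suc p) * y ^ p * (z - y)\<^sup>2 \<ge> 0" using assms by simp
  ultimately show ?case by linarith
qed

text \<open>
  Adding a number \<open>x\<close> to numbers with mean \<open>y\<close> moves the mean to \<open>z = y + (x - y) / (n + 1)\<close>.  The recursion of
  \<open>esym\<close> makes the left side at most \<open>n + 1 choose m\<close> times the tangent of the \<open>m\<close>-th power at \<open>y\<close>, evaluated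
  at \<open>z\<close>.
\<close>

lemma maclaurin_inequality:
  fixes u :: "'b \<Rightarrow> real"
  assumes "finite A" "\<And>i. i \<in> A \<Longrightarrow> u i \<ge> 0"
  shows "esym m A u \<le> real (card A choose m) * ((\<Sum>i\<in>A. u i) / card A) ^ m"
  using assms
proof (induction A arbitrary: m rule: finite_induct)
  case empty
  then show ?case by (cases m) (auto simp: esym_0 esym_Suc_empty)
next
  case (insert a A)
  show ?case
  proof (cases m)
    case 0
    then show ?thesis using insert.hyps by (simp add: esym_0)
  next
    case (Suc p)
    define n x y z where "n = card A" and "x = u a" and "y = (\<Sum>i\<in>A. u i) / n"
      and "z = (n * y + x) / real (Suc n)"
    have nn: "x \<ge> 0" "y \<ge> 0" "z \<ge> 0"
      using insert.prems by (auto simp: x_def y_def z_def intro!: divide_nonneg_nonneg sum_nonneg add_nonneg_nonneg)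
    have ny: "n * y = (\<Sum>i\<in>A. u i)" using insert.hyps by (cases "A = {}") (auto simp: n_def y_def)
    have "esym m (insert a A) u = esym (Suc p) A u + x * esym p A u"
      using insert.hyps Suc by (simp add: esym_Suc_insert x_def)
    also have "\<dots> \<le> real (n choose Suc p) * y ^ Suc p + x * (real (n choose p) * y ^ p)"
    proof -
      have "esym k A u \<le> real (n choose k) * y ^ k" for k
        unfolding n_def y_def by (rule insert.IH) (use insert.prems in auto)
      then show ?thesis using nn by (intro add_mono mult_left_mono)
    qed
    also have "\<dots> = real (Suc n choose Suc p) * y ^ Suc p + real (n choose p) * y ^ p * (x - y)"
      by (simp add: algebra_simps)
    also have "real (n choose p) * y ^ p * (x - y)
      = real (Suc n choose Suc p) * (real (Suc p) * y ^ p * (z - y))"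
    proof -
      have 1: "real (Suc p) * real (Suc n choose Suc p) = real (Suc n) * real (n choose p)"
        using Suc_times_binomial[of p n] by (metis of_nat_mult)
      have 2: "x - y = real (Suc n) * (z - y)" by (simp add: z_def field_simps)
      have "real (n choose p) * y ^ p * (x - y) = (real (Suc n) * real (n choose p)) * (y ^ p * (z - y))"
        unfolding 2 by (simp only: mult_ac)
      then show ?thesis unfolding 1[symmetric] by (simp only: mult_ac)
    qed
    also have "real (Suc n choose Suc p) * y ^ Suc p + \<dots>
      = real (Suc n choose Suc p) * (y ^ Suc p + real (Suc p) * y ^ p * (z - y))"
      by (simp only: distrib_left)
    also have "\<dots> \<le> real (Suc n choose Suc p) * z ^ Suc p"
      using nn by (intro mult_left_mono power_above_tangent) auto
    finally have "esym m (insert a A) u \<le> real (Suc n choose Suc p) * z ^ Suc p" .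
    moreover have "z = (\<Sum>i\<in>insert a A. u i) / Suc n"
      unfolding z_def ny x_def using insert.hyps by (simp add: add.commute)
    moreover have "card (insert a A) = Suc n" using insert.hyps by (simp add: n_def)
    ultimately show ?thesis unfolding Suc by (simp only:)
  qed
qed

text \<open>
  The coefficient of \<open>t ^ m\<close> in the product of the linear factors \<open>t * u i + v i\<close>.
\<close>

definition mixed_esym :: "nat \<Rightarrow> 'b set \<Rightarrow> ('b \<Rightarrow> real) \<Rightarrow> ('b \<Rightarrow> real) \<Rightarrow> real" where
  "mixed_esym m A u v = (\<Sum>T | T \<subseteq> A \<and> card T = m. (\<Prod>i\<in>T. u i) * (\<Prod>i\<in>A - T. v i))"

lemma mixed_esym_nonneg:
  fixes u v :: "'b \<Rightarrow> real"
  assumes "\<And>i. i \<in> A \<Longrightarrow> u i \<ge> 0" "\<And>i. i \<in> A \<Longrightarrow> v i \<ge> 0"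
  shows "mixed_esym m A u v \<ge> 0"
  unfolding mixed_esym_def using assms by (intro sum_nonneg mult_nonneg_nonneg prod_nonneg) auto

lemma mixed_esym_le_mean:
  fixes u v :: "'b \<Rightarrow> real"
  assumes "finite A" "\<And>i. i \<in> A \<Longrightarrow> u i \<ge> 0" "\<And>i. i \<in> A \<Longrightarrow> 0 \<le> v i \<and> v i \<le> 1"
  shows "mixed_esym m A u v \<le> real (card A choose m) * ((\<Sum>i\<in>A. u i) / card A) ^ m"
proof -
  have "mixed_esym m A u v \<le> esym m A u"
    unfolding mixed_esym_def esym_def
    using assms by (intro sum_mono mult_right_le_one_le prod_nonneg prod_le_1) auto
  also have "\<dots> \<le> real (card A choose m) * ((\<Sum>i\<in>A. u i) / card A) ^ m"
    using assms by (intro maclaurin_inequality) auto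
  finally show ?thesis .
qed

text \<open>
  The sum is the product of the factors \<open>t * u i + v i\<close>, whose mean is at most \<open>1\<close>.
\<close>

lemma sum_mixed_esym_le_1:
  fixes u v :: "'b \<Rightarrow> real" and t :: real
  assumes "finite A" "\<And>i. i \<in> A \<Longrightarrow> u i \<ge> 0" "\<And>i. i \<in> A \<Longrightarrow> v i \<ge> 0" "t \<ge> 0"
    and "t * (\<Sum>i\<in>A. u i) + (\<Sum>i\<in>A. v i) \<le> card A"
  shows "(\<Sum>m\<le>card A. t ^ m * mixed_esym m A u v) \<le> 1"
proof -
  have "(\<Sum>m\<le>card A. t ^ m * mixed_esym m A u v)
    = (\<Sum>m\<le>card A. \<Sum>T\<in>{T \<in> Pow A. card T = m}. (\<Prod>i\<in>T. t * u i) * (\<Prod>i\<in>A - T. v i))"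
    by (intro sum.cong refl) (auto simp: mixed_esym_def sum_distrib_left prod.distrib mult.assoc)
  also have "\<dots> = (\<Sum>T\<in>Pow A. (\<Prod>i\<in>T. t * u i) * (\<Prod>i\<in>A - T. v i))"
    using assms(1) by (intro sum.group) (auto intro: card_mono)
  also have "\<dots> = (\<Prod>i\<in>A. t * u i + v i)" by (rule prod_add[OF assms(1), symmetric])
  also have "\<dots> \<le> 1"
    using assms by (intro prod_le_1_of_sum_le_card) (auto simp: sum.distrib sum_distrib_left)
  finally show ?thesis .
qed

lemma mixed_esym_le_power:
  fixes u v :: "'b \<Rightarrow> real" and t :: real
  assumes "finite A" "\<And>i. i \<in> A \<Longrightarrow> u i \<ge> 0" "\<And>i. i \<in> A \<Longrightarrow> v i \<ge> 0" "t > 0"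
    and "t * (\<Sum>i\<in>A. u i) + (\<Sum>i\<in>A. v i) \<le> card A" and m: "m \<le> card A"
  shows "mixed_esym m A u v \<le> (1 / t) ^ m"
proof -
  have "t ^ m * mixed_esym m A u v \<le> (\<Sum>m\<le>card A. t ^ m * mixed_esym m A u v)"
    using assms by (intro member_le_sum) (auto intro!: mult_nonneg_nonneg mixed_esym_nonneg)
  also have "\<dots> \<le> 1" using assms by (intro sum_mixed_esym_le_1) auto
  finally show ?thesis using \<open>t > 0\<close> by (simp add: field_simps)
qed

lemma sum_subsets_Cauchy_Schwarz:
  fixes f :: "'b set \<Rightarrow> real"
  assumes "finite A"
  shows "(\<Sum>T | T \<subseteq> A \<and> card T = m. f T)\<^sup>2 \<le> real (card A choose m) * (\<Sum>T | T \<subseteq> A \<and> card T = m. (f T)\<^sup>2)"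
  using Cauchy_Schwarz_ineq_sum[of "\<lambda>_. 1" f "{T. T \<subseteq> A \<and> card T = m}"] n_subsets[OF assms, of m] by simp

lemma mixed_esym_square_le:
  assumes "finite A"
  shows "(mixed_esym m A u v)\<^sup>2 \<le> real (card A choose m) * mixed_esym m A (\<lambda>i. (u i)\<^sup>2) (\<lambda>i. (v i)\<^sup>2)"
  using sum_subsets_Cauchy_Schwarz[OF assms, where m = m and f = "\<lambda>T. (\<Prod>i\<in>T. u i) * (\<Prod>i\<in>A - T. v i)"]
  by (simp add: mixed_esym_def power_mult_distrib prod_power_distrib)

section \<open>Permanents of zero-sum columns\<close>

lemma inj_sum_swap_columns:
  assumes fin: "finite K" and ik: "i \<in> K" "k \<in> K"
  shows "inj_sum K R (\<lambda>l. X (Transposition.transpose i k l)) = inj_sum K R X"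
proof -
  let ?t = "Transposition.transpose i k"
  have inK: "?t l \<in> K \<longleftrightarrow> l \<in> K" for l using ik by (metis transpose_apply_other transpose_apply_first transpose_apply_second)
  then have bij: "bij_betw ?t K K"
    by (intro bij_betw_byWitness[where f' = ?t]) auto
  have mem: "J \<circ> ?t \<in> injections K R" if "J \<in> injections K R" for J
  proof -
    have "inj_on (J \<circ> ?t) K"
      using that bij by (auto simp: injections_def bij_betw_def intro!: comp_inj_on)
    then show ?thesis using that inK by (auto simp: injections_def PiE_iff extensional_def)
  qed
  show ?thesis unfolding inj_sum_def
  proof (rule sum.reindex_bij_witness[where i = "\<lambda>J. J \<circ> ?t" and j = "\<lambda>J. J \<circ> ?t"])
    fix J
    show "(\<Prod>l\<in>K. X l ((J \<circ> ?t) l)) = (\<Prod>l\<in>K. X (?t l) (J l))"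
      using prod.reindex_bij_betw[OF bij, of "\<lambda>l. X l ((J \<circ> ?t) l)"] by simp
  qed (auto simp: mem comp_assoc)
qed

lemma inj_sum_split_column:
  assumes "finite K" "i \<in> K"
  shows "inj_sum K R (X(i := f)) = (\<Sum>J\<in>injections K R. f (J i) * (\<Prod>k\<in>K - {i}. X k (J k)))"
proof -
  have "(\<Prod>k\<in>K. (X(i := f)) k (J k)) = f (J i) * (\<Prod>k\<in>K - {i}. X k (J k))" for J
    using assms by (subst prod.remove[of K i]) (auto intro!: prod.cong)
  then show ?thesis by (simp add: inj_sum_def)
qed

lemma inj_sum_scale_columns:
  "inj_sum K R (\<lambda>k j. c k * X k j) = (\<Prod>k\<in>K. c k) * inj_sum K R X"
  by (simp add: inj_sum_def prod.distrib sum_distrib_left)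

text \<open>
  Cauchy's estimate.  Averaging over the roots of unity of an order above the degree recovers the
  coefficient exactly.
\<close>

lemma polynomial_coeff_bound:
  fixes c :: "nat \<Rightarrow> complex"
  assumes B: "\<And>z. cmod z = 1 \<Longrightarrow> cmod (\<Sum>k\<le>N. c k * z ^ k) \<le> B" and m: "m \<le> N"
  shows "cmod (c m) \<le> B"
proof -
  define M where "M = Suc N"
  define w where "w = (\<lambda>l. cis (2 * pi * real l / real M))"
  have M: "M > 0" by (simp add: M_def)
  have bij: "bij_betw w {..<M} {z. z ^ M = 1}" unfolding w_def by (rule Complex.bij_betw_roots_unity[OF M])
  have w_pow: "w k ^ l = w l ^ k" for k l
    unfolding w_def Complex.DeMoivre by (simp add: mult_ac)
  have w0: "w l \<noteq> 0" for l by (simp add: w_def)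
  have orth: "(\<Sum>l<M. w l ^ k / w l ^ m) = (if k = m then of_nat M else 0)" if k: "k \<le> N" for k
  proof (cases "k = m")
    case True
    then show ?thesis using w0 by simp
  next
    case False
    define x where "x = w k / w m"
    have "w k \<noteq> w m"
      using bij False k m by (auto simp: bij_betw_def inj_on_def M_def)
    then have x1: "x \<noteq> 1" using w0 by (simp add: x_def)
    have "w k ^ M = 1" "w m ^ M = 1" using bij k m by (auto simp: bij_betw_def M_def)
    then have "x ^ M = 1" by (simp add: x_def power_divide)
    have "(\<Sum>l<M. w l ^ k / w l ^ m) = (\<Sum>l<M. x ^ l)"
      by (simp add: w_pow[of _ k] w_pow[of _ m] x_def power_divide)
    also have "\<dots> = 0" using geometric_sum[OF x1, of M] \<open>x ^ M = 1\<close> by simp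
    finally show ?thesis using False by simp
  qed
  have "(\<Sum>l<M. (\<Sum>k\<le>N. c k * w l ^ k) / w l ^ m) = (\<Sum>k\<le>N. c k * (\<Sum>l<M. w l ^ k / w l ^ m))"
    by (simp add: sum_divide_distrib sum_distrib_left, subst sum.swap) simp
  also have "\<dots> = (\<Sum>k\<le>N. if k = m then c k * of_nat M else 0)"
    by (intro sum.cong refl) (simp add: orth)
  also have "\<dots> = c m * of_nat M" using m by simp
  finally have "cmod (c m) * real M = cmod (\<Sum>l<M. (\<Sum>k\<le>N. c k * w l ^ k) / w l ^ m)"
    by (simp add: norm_mult)
  also have "\<dots> \<le> (\<Sum>l<M. B)"
    by (intro sum_norm_le) (simp add: norm_divide norm_power w_def B)
  finally show ?thesis using M by simp
qed

text \<open>
  The weights \<open>t\<^sup>2 = m\<close> and \<open>a\<^sup>2 = (N - m) / N\<close>, where \<open>N = card R\<close>, make the squared moduli of the factors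
  \<open>t z f\<^sub>j + a\<close> have sum at most \<open>t\<^sup>2 + N a\<^sup>2 = N\<close> on the unit circle: the mixed terms cancel because \<open>f\<close> has
  sum zero.  These weights optimise the bound for the coefficient of \<open>z\<^sup>m\<close>, and they include the
  case \<open>m = N\<close>.
\<close>

lemma esym_zero_sum_bound:
  assumes fin: "finite R" and m: "m \<le> card R" and R: "card R > 0"
    and zero: "(\<Sum>j\<in>R. f j) = 0" and norm: "sqnorm R f \<le> 1"
  shows "(cmod (esym m R f))\<^sup>2 * (real m ^ m * ((real (card R) - real m) / real (card R)) ^ (card R - m)) \<le> 1"
proof -
  define N where "N = card R"
  define t a where "t = sqrt (real m)" and "a = sqrt ((real N - real m) / real N)"
  have ta: "t\<^sup>2 = real m" "a\<^sup>2 = (real N - real m) / real N" using m R by (auto simp: t_def a_def N_def)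
  define c where "c = (\<lambda>k. of_real (t ^ k * a ^ (N - k)) * esym k R f)"
  have "cmod (c m) \<le> 1"
  proof (rule polynomial_coeff_bound)
    fix z :: complex assume z: "cmod z = 1"
    have entry: "(cmod ((of_real t * z) * f j + of_real a))\<^sup>2
        = t\<^sup>2 * (cmod (f j))\<^sup>2 + a\<^sup>2 + 2 * a * t * Re (z * f j)" for j
    proof -
      have "(cmod (z * f j))\<^sup>2 = (cmod (f j))\<^sup>2" using z by (simp add: norm_mult)
      moreover have "(cmod (of_real t * g + of_real a))\<^sup>2 = t\<^sup>2 * (cmod g)\<^sup>2 + a\<^sup>2 + 2 * a * t * Re g" for g
        unfolding cmod_power2 by (simp add: power2_eq_square algebra_simps)
      ultimately show ?thesis by (simp add: mult.assoc)
    qed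
    have "(\<Sum>j\<in>R. (cmod ((of_real t * z) * f j + of_real a))\<^sup>2)
        = t\<^sup>2 * sqnorm R f + N * a\<^sup>2 + 2 * a * t * Re (z * (\<Sum>j\<in>R. f j))"
      unfolding entry by (simp add: sum.distrib sqnorm_eq sum_distrib_left N_def)
    also have "\<dots> \<le> t\<^sup>2 * 1 + N * a\<^sup>2"
      using zero mult_left_mono[OF norm, of "t\<^sup>2"] by simp
    also have "\<dots> = N" using R by (simp add: ta N_def)
    finally have "(\<Prod>j\<in>R. (cmod ((of_real t * z) * f j + of_real a))\<^sup>2) \<le> 1"
      using fin by (intro prod_le_1_of_sum_le_card) (auto simp: N_def)
    then have "(cmod (\<Prod>j\<in>R. (of_real t * z) * f j + of_real a))\<^sup>2 \<le> 1"
      by (simp add: prod_norm prod_power_distrib flip: prod_norm)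
    also have "(\<Prod>j\<in>R. (of_real t * z) * f j + of_real a) = (\<Sum>k\<le>N. c k * z ^ k)"
      unfolding prod_add_const_mult[OF fin] by (simp add: c_def N_def power_mult_distrib mult_ac)
    finally have "(cmod (\<Sum>k\<le>N. c k * z ^ k))\<^sup>2 \<le> 1" .
    then show "cmod (\<Sum>k\<le>N. c k * z ^ k) \<le> 1" unfolding abs_square_le_1 by (simp only: abs_norm_cancel)
  qed (use m in \<open>simp add: N_def\<close>)
  then have "(cmod (c m))\<^sup>2 \<le> 1" by (simp add: power_le_one)
  also have "cmod (c m) = \<bar>t ^ m * a ^ (N - m)\<bar> * cmod (esym m R f)"
    unfolding c_def norm_mult norm_of_real ..
  also have "(\<bar>t ^ m * a ^ (N - m)\<bar> * cmod (esym m R f))\<^sup>2 = (cmod (esym m R f))\<^sup>2 * ((t\<^sup>2) ^ m * (a\<^sup>2) ^ (N - m))"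
    by (simp add: power_mult_distrib mult.commute flip: power_mult)
  finally show ?thesis unfolding ta by (simp add: N_def)
qed

text \<open>
  By Stirling's formula this grows like \<open>sqrt (2 * pi * m)\<close>; it equals \<open>sqrt m * (C m)\<^sup>2\<close> for \<open>m \<ge> 1\<close>, and its
  value at \<open>0\<close> is \<open>1\<close>.
\<close>

definition stirling_factor :: "nat \<Rightarrow> real" where
  "stirling_factor m = fact m * exp (real m) / real m ^ m"

lemma stirling_factor_pos: "stirling_factor m > 0"
  by (cases m) (auto simp: stirling_factor_def)

lemma stirling_factor_mono: "m \<le> m' \<Longrightarrow> stirling_factor m \<le> stirling_factor m'"
proof (rule lift_Suc_mono_le[of stirling_factor])
  fix m
  show "stirling_factor m \<le> stirling_factor (Suc m)"
  proof (cases "m = 0")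
    case False
    have "1 + 1 / real m \<le> exp (1 / real m)" by (rule exp_ge_add_one_self)
    then have "(1 + 1 / real m) ^ m \<le> exp (1 / real m) ^ m" by (intro power_mono) auto
    also have "\<dots> = exp 1" using False by (simp flip: exp_of_nat_mult)
    also have "1 + 1 / real m = (real m + 1) / real m" using False by (simp add: field_simps)
    finally have "(real m + 1) ^ m \<le> exp 1 * real m ^ m" using False by (simp add: power_divide field_simps)
    then have "fact m * exp (real m) * (real m + 1) ^ m \<le> fact m * exp (real m) * (exp 1 * real m ^ m)"
      by (intro mult_left_mono) auto
    then show ?thesis using False
      by (simp add: stirling_factor_def exp_add divide_simps) (simp add: algebra_simps)
  qed (simp add: stirling_factor_def)
qed

text \<open>
  Banach's theorem reduces the bound to equal columns, where it is \<open>esym_zero_sum_bound\<close>.  What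
  remains is to trade the optimal constant for factorials:
  \<open>N\<^sup>N / (N - m)\<^bsup>N - m\<^esup> \<le> e\<^sup>m N! / (N - m)!\<close> because \<open>stirling_factor\<close> increases.
\<close>

theorem inj_sum_zero_sum_columns_bound:
  assumes fin: "finite K" "finite R" and card: "card K \<le> card R" and R: "card R > 0"
    and zero: "\<And>k. k \<in> K \<Longrightarrow> (\<Sum>j\<in>R. X k j) = 0"
  shows "(cmod (inj_sum K R X))\<^sup>2 * real (card R) ^ card K
    \<le> fact (card K) * stirling_factor (card K) * (fact (card R) / fact (card R - card K))
      * (\<Prod>k\<in>K. sqnorm R (X k))"
proof -
  define m N where "m = card K" and "N = card R"
  have mN: "m \<le> N" "N > 0" using card R by (auto simp: m_def N_def)
  define Q where "Q = real m ^ m * ((real N - real m) / real N) ^ (N - m)"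
  have Q: "Q > 0" using mN by (cases "m = N") (auto simp: Q_def zero_less_power_eq power_0_left intro!: mult_pos_pos)
  define V where "V = {f :: nat \<Rightarrow> complex. (\<forall>j. j \<notin> R \<longrightarrow> f j = 0) \<and> (\<Sum>j\<in>R. f j) = 0}"
  have closedV: "closed V"
  proof -
    have "V = (\<Inter>j\<in>-R. {f. f j = 0}) \<inter> {f. (\<Sum>j\<in>R. f j) = 0}" by (auto simp: V_def)
    moreover have "closed {f :: nat \<Rightarrow> complex. f j = 0}" for j
      by (intro closed_Collect_eq continuous_intros) simp
    moreover have "closed {f :: nat \<Rightarrow> complex. (\<Sum>j\<in>R. f j) = 0}"
      by (intro closed_Collect_eq continuous_intros) simp
    ultimately show ?thesis by (auto intro!: closed_Int closed_INT)
  qed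
  have unit: "cmod (inj_sum K R Y) \<le> fact m / sqrt Q"
    if Y: "\<And>k. k \<in> K \<Longrightarrow> Y k \<in> V" "\<And>k. k \<in> K \<Longrightarrow> sqnorm R (Y k) \<le> 1" "\<And>k. k \<notin> K \<Longrightarrow> Y k = (\<lambda>_. 0)" for Y
  proof (rule symmetric_multilinear_bound[OF fin closedV, where L = "inj_sum K R"])
    show "continuous_on UNIV (inj_sum K R)"
      unfolding inj_sum_def by (intro continuous_intros continuous_on_entry)
  next
    fix X :: "nat \<Rightarrow> nat \<Rightarrow> complex" and i k f g assume "i \<in> K" "k \<in> K" "i \<noteq> k"
    moreover from this have "(\<lambda>l. (X(i := g, k := f)) (Transposition.transpose i k l)) = X(i := f, k := g)"
      by (auto simp: Transposition.transpose_def fun_eq_iff)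
    ultimately show "inj_sum K R (X(i := f, k := g)) = inj_sum K R (X(i := g, k := f))"
      using inj_sum_swap_columns[OF fin(1), of i k R "X(i := g, k := f)"] by simp
  next
    fix f assume f: "f \<in> V" "sqnorm R f \<le> 1"
    have "inj_sum K R (\<lambda>i. if i \<in> K then f else (\<lambda>_. 0)) = inj_sum K R (\<lambda>_. f)"
      by (rule inj_sum_cong) auto
    also have "\<dots> = fact m * esym m R f" using inj_sum_equal_columns[OF fin] by (simp add: m_def)
    finally have eq: "cmod (inj_sum K R (\<lambda>i. if i \<in> K then f else (\<lambda>_. 0))) = fact m * cmod (esym m R f)"
      by (simp add: norm_mult)
    have "(cmod (esym m R f))\<^sup>2 * Q \<le> 1"
      using esym_zero_sum_bound[OF fin(2), of m f] mN f by (simp add: Q_def N_def V_def)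
    then have "cmod (esym m R f) \<le> 1 / sqrt Q"
      using Q by - (rule power2_le_imp_le, simp_all add: power_divide pos_le_divide_eq)
    then show "cmod (inj_sum K R (\<lambda>i. if i \<in> K then f else (\<lambda>_. 0))) \<le> fact m / sqrt Q"
      unfolding eq using mult_left_mono[of "cmod (esym m R f)" "1 / sqrt Q" "fact m"] by simp
  next
    fix f g c assume "f \<in> V" "g \<in> V"
    then show "(\<lambda>j. f j + g j) \<in> V" "(\<lambda>j. c *\<^sub>R f j) \<in> V"
      by (auto simp: V_def sum.distrib simp flip: scaleR_right.sum)
  next
    fix X :: "nat \<Rightarrow> nat \<Rightarrow> complex" and i f g and c :: real assume "i \<in> K"
    then show "inj_sum K R (X(i := \<lambda>j. f j + g j)) = inj_sum K R (X(i := f)) + inj_sum K R (X(i := g))"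
      "inj_sum K R (X(i := \<lambda>j. c *\<^sub>R f j)) = c *\<^sub>R inj_sum K R (X(i := f))"
      using fin(1) by (simp_all add: inj_sum_split_column distrib_right sum.distrib scaleR_right.sum)
  qed (use Y in \<open>auto simp: V_def\<close>)
  \<comment> \<open>Normalise the columns.  A zero column has \<open>c k = 0\<close>, and division by zero turns it into the zero
     vector, as needed.\<close>
  define c where "c = (\<lambda>k. sqrt (sqnorm R (X k)))"
  define Y where "Y = (\<lambda>k j. if k \<in> K \<and> j \<in> R then X k j / of_real (c k) else 0)"
  have c0: "X k j = 0" if "c k = 0" "j \<in> R" for k j
  proof -
    have "sqnorm R (X k) = 0" using that sqnorm_nonneg[of R "X k"] by (simp add: c_def)
    then show ?thesis using that fin by (auto simp: sqnorm_eq sum_nonneg_eq_0_iff)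
  qed
  have c2: "(c k)\<^sup>2 = sqnorm R (X k)" for k by (simp add: c_def sqnorm_nonneg)
  have "inj_sum K R X = inj_sum K R (\<lambda>k j. of_real (c k) * Y k j)"
    by (rule inj_sum_cong) (use c0 in \<open>auto simp: Y_def\<close>)
  then have "cmod (inj_sum K R X) = (\<Prod>k\<in>K. c k) * cmod (inj_sum K R Y)"
    by (simp add: inj_sum_scale_columns norm_mult c_def sqnorm_nonneg abs_prod flip: prod_norm)
  also have "\<dots> \<le> (\<Prod>k\<in>K. c k) * (fact m / sqrt Q)"
  proof (intro mult_left_mono unit)
    fix k assume k: "k \<in> K"
    have "(\<Sum>j\<in>R. Y k j) = (\<Sum>j\<in>R. X k j) / of_real (c k)"
      using k by (simp add: Y_def sum_divide_distrib)
    then show "Y k \<in> V" using zero[OF k] by (simp add: V_def) (simp add: Y_def)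
    have "sqnorm R (Y k) = (\<Sum>j\<in>R. (cmod (X k j))\<^sup>2 / (c k)\<^sup>2)"
      unfolding sqnorm_eq using k by (intro sum.cong) (auto simp: Y_def norm_divide power_divide)
    also have "\<dots> = (c k)\<^sup>2 / (c k)\<^sup>2" unfolding c2 sqnorm_eq by (rule sum_divide_distrib[symmetric])
    finally show "sqnorm R (Y k) \<le> 1" by (cases "c k = 0") auto
  next
    show "0 \<le> prod c K" by (intro prod_nonneg) (simp add: c_def sqnorm_nonneg)
  qed (auto simp: Y_def)
  finally have "(cmod (inj_sum K R X))\<^sup>2 \<le> ((\<Prod>k\<in>K. c k) * (fact m / sqrt Q))\<^sup>2"
    by (intro power_mono) auto
  also have "\<dots> = (\<Prod>k\<in>K. sqnorm R (X k)) * ((fact m)\<^sup>2 / Q)"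
    using Q by (simp add: power_mult_distrib power_divide prod_power_distrib c2)
  finally have main: "(cmod (inj_sum K R X))\<^sup>2 * real N ^ m \<le> (\<Prod>k\<in>K. sqnorm R (X k)) * ((fact m)\<^sup>2 / Q * real N ^ m)"
    by (auto dest: mult_right_mono[of _ _ "real N ^ m"] simp: mult.assoc)
  have "stirling_factor (N - m) \<le> stirling_factor N" by (rule stirling_factor_mono) simp
  then have "fact (N - m) * exp (real (N - m)) * real N ^ N \<le> fact N * exp (real N) * real (N - m) ^ (N - m)"
    using mN by (cases "m = N") (auto simp: stirling_factor_def divide_simps)
  also have "exp (real N) = exp (real (N - m)) * exp (real m)" using mN by (simp flip: exp_add)
  finally have "exp (real (N - m)) * (fact (N - m) * real N ^ N)
      \<le> exp (real (N - m)) * (fact N * exp (real m) * real (N - m) ^ (N - m))" by (simp add: mult_ac)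
  then have *: "fact (N - m) * real N ^ N \<le> fact N * exp (real m) * real (N - m) ^ (N - m)" by simp
  have NN: "real N ^ N = real N ^ m * real N ^ (N - m)" using mN by (simp flip: power_add)
  have Q': "Q = real m ^ m * real (N - m) ^ (N - m) / real N ^ (N - m)"
    using mN by (simp add: Q_def power_divide of_nat_diff)
  have pos: "real m ^ m > 0" "real (N - m) ^ (N - m) > 0" using mN by (auto simp: zero_less_power_eq power_0_left)
  have "(fact m)\<^sup>2 / Q * real N ^ m = fact m * (fact m * real N ^ N / (real m ^ m * real (N - m) ^ (N - m)))"
    unfolding NN Q' using mN by (simp add: power2_eq_square)
  also have "\<dots> \<le> fact m * (stirling_factor m * (fact N / fact (N - m)))"
    using mult_left_mono[OF *, of "fact m :: real"] pos
    by (intro mult_left_mono) (simp_all add: stirling_factor_def divide_simps mult_ac)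
  finally have "(\<Prod>k\<in>K. sqnorm R (X k)) * ((fact m)\<^sup>2 / Q * real N ^ m)
      \<le> (\<Prod>k\<in>K. sqnorm R (X k)) * (fact m * (stirling_factor m * (fact N / fact (N - m))))"
    by (intro mult_left_mono prod_nonneg) (auto simp: sqnorm_nonneg)
  with main show ?thesis by (simp add: m_def N_def mult_ac)
qed

section \<open>The remainder series\<close>

lemma ln_add_one_lower_bound:
  assumes "(x::real) \<ge> 0"
  shows "2 * x / (2 + x) \<le> ln (1 + x)"
proof -
  have "ln (1 + 0) - 2 * 0 / (2 + 0) \<le> ln (1 + x) - 2 * x / (2 + x)"
  proof (rule DERIV_nonneg_imp_nondecreasing[OF assms])
    fix y :: real assume "0 \<le> y" "y \<le> x"
    then have "((\<lambda>y. ln (1 + y) - 2 * y / (2 + y)) has_real_derivative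
        1 / (1 + y) - (2 * (2 + y) - 2 * y) / ((2 + y) * (2 + y))) (at y)"
      by (auto intro!: derivative_eq_intros)
    moreover have "1 / (1 + y) - (2 * (2 + y) - 2 * y) / ((2 + y) * (2 + y)) = y\<^sup>2 / ((1 + y) * (2 + y)\<^sup>2)"
      using \<open>0 \<le> y\<close> by (simp add: divide_simps power2_eq_square) (simp add: algebra_simps)
    ultimately show "\<exists>d. ((\<lambda>y. ln (1 + y) - 2 * y / (2 + y)) has_real_derivative d) (at y) \<and> 0 \<le> d"
      using \<open>0 \<le> y\<close> by force
  qed
  then show ?thesis by simp
qed

text \<open>
  After taking logarithms, the bound \<open>ln (1 + x) \<ge> 2 x / (2 + x)\<close> is applied at \<open>1 / m\<close> and at
  \<open>1 / (2 m)\<close>.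
\<close>

lemma exp_1_upper_bound:
  assumes m: "m \<ge> 1"
  shows "exp 1 \<le> (1 + 1 / real m) ^ m * (1 + 1 / (2 * real m))"
proof -
  define x where "x = 1 / real m"
  have x: "x > 0" "real m * x = 1" using m by (auto simp: x_def)
  have "1 \<le> 2 / (2 + x) + 2 * (x / 2) / (2 + x / 2)"
    using x by (simp add: divide_simps) (simp add: algebra_simps)
  also have "2 / (2 + x) = real m * (2 * x / (2 + x))"
    using x by (simp add: x(2) mult.left_commute[of "real m" 2])
  also have "real m * (2 * x / (2 + x)) + 2 * (x / 2) / (2 + x / 2) \<le> real m * ln (1 + x) + ln (1 + x / 2)"
    using x by (intro add_mono mult_left_mono ln_add_one_lower_bound) auto
  also have "\<dots> = ln ((1 + x) ^ m * (1 + x / 2))"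
    using x by (subst ln_mult) (auto simp: ln_realpow)
  finally have "1 \<le> ln ((1 + x) ^ m * (1 + x / 2))" .
  then have "exp 1 \<le> (1 + x) ^ m * (1 + x / 2)" using x by (subst (asm) ln_ge_iff) auto
  then show ?thesis by (simp add: x_def mult.commute)
qed

lemma stirling_factor_Suc_le:
  assumes m: "m \<ge> 1"
  shows "stirling_factor (Suc m) \<le> stirling_factor m * (1 + 1 / (2 * real m))"
proof -
  define P Q w where "P = real m ^ m" and "Q = (real m + 1) ^ m" and "w = 1 + 1 / (2 * real m)"
  have pos: "P > 0" "Q > 0" using m by (auto simp: P_def Q_def)
  have "1 + 1 / real m = (real m + 1) / real m" using m by (simp add: field_simps)
  then have "exp 1 \<le> Q / P * w"
    using exp_1_upper_bound[OF m] by (simp add: P_def Q_def w_def power_divide)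
  then have "exp 1 / Q \<le> w / P" using pos by (simp add: field_simps)
  then have "fact m * exp (real m) * (exp 1 / Q) \<le> fact m * exp (real m) * (w / P)" by (intro mult_left_mono) auto
  moreover have "stirling_factor (Suc m) = fact m * exp (real m) * (exp 1 / Q)"
  proof -
    have "fact (Suc m) = (real m + 1) * fact m" "real (Suc m) = real m + 1" "real m + 1 \<noteq> 0" by auto
    then show ?thesis unfolding stirling_factor_def Q_def by (simp only: exp_add power_Suc) simp
  qed
  ultimately show ?thesis by (simp add: stirling_factor_def P_def w_def)
qed

text \<open>
  The numbers \<open>pochhammer (3 / 2) k / fact k\<close> are the coefficients of the power series of
  \<open>(1 - x) powr (-3 / 2)\<close>.  Their ratios \<open>1 + 1 / (2 (k + 1))\<close> are at least \<open>1 + 1 / (2 (r + k))\<close>, as \<open>r \<ge> 1\<close>,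
  and this bounds the ratios of the Stirling factors.
\<close>

lemma stirling_factor_add_le:
  assumes r: "r \<ge> 1"
  shows "stirling_factor (r + k) \<le> stirling_factor r * (pochhammer (3 / 2) k / fact k)"
proof (induction k)
  case (Suc k)
  have "stirling_factor (r + Suc k) \<le> stirling_factor (r + k) * (1 + 1 / (2 * real (r + k)))"
    using stirling_factor_Suc_le[of "r + k"] r by simp
  also have "\<dots> \<le> stirling_factor (r + k) * (1 + 1 / (2 * real (Suc k)))"
    using r stirling_factor_pos[of "r + k"] by (intro mult_left_mono add_left_mono divide_left_mono) auto
  also have "\<dots> \<le> stirling_factor r * (pochhammer (3 / 2) k / fact k) * (1 + 1 / (2 * real (Suc k)))"
    using Suc by (intro mult_right_mono) auto
  also have "\<dots> = stirling_factor r * (pochhammer (3 / 2) (Suc k) / fact (Suc k))"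
    by (simp add: pochhammer_Suc field_simps)
  finally show ?case .
qed simp

lemma sum_pochhammer_power_le:
  fixes x :: real
  assumes x: "0 \<le> x" "x < 1"
  shows "(\<Sum>k<K. pochhammer (3 / 2) k / fact k * x ^ k) \<le> (1 - x) powr (-3 / 2)"
proof -
  have "(\<lambda>k. ((-3 / 2) gchoose k) * (-x) ^ k) sums (1 + (-x)) powr (-3 / 2)"
    using x by (intro gen_binomial_real) auto
  moreover have "((-3 / 2) gchoose k) * (-x) ^ k = pochhammer (3 / 2) k / fact k * x ^ k" for k
  proof -
    have "((-3 / 2) gchoose k) * (-x) ^ k = pochhammer (3 / 2) k / fact k * ((-1) ^ k * (-x) ^ k)"
      unfolding gbinomial_pochhammer by simp
    also have "(-1) ^ k * (-x) ^ k = x ^ k" by (simp flip: power_mult_distrib)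
    finally show ?thesis .
  qed
  ultimately have s: "(\<lambda>k. pochhammer (3 / 2) k / fact k * x ^ k) sums (1 - x) powr (-3 / 2)" by simp
  show ?thesis
    using x by (intro sum_le_suminf[OF sums_summable[OF s], unfolded sums_unique[OF s, symmetric]])
      (auto intro!: mult_nonneg_nonneg divide_nonneg_nonneg pochhammer_nonneg)
qed

lemma sum_stirling_factor_power_le:
  assumes r: "r \<ge> 1" and x: "0 \<le> x" "x < 1"
  shows "(\<Sum>m=r..n. stirling_factor m * x ^ m) \<le> stirling_factor r * x ^ r * (1 - x) powr (-3 / 2)"
proof (cases "r \<le> n")
  case True
  have "(\<Sum>m=r..n. stirling_factor m * x ^ m) = (\<Sum>k<Suc n - r. stirling_factor (r + k) * x ^ (r + k))"
    by (rule sum.reindex_bij_witness[where i = "\<lambda>k. r + k" and j = "\<lambda>m. m - r"]) auto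
  also have "\<dots> \<le> (\<Sum>k<Suc n - r. stirling_factor r * (pochhammer (3 / 2) k / fact k) * x ^ (r + k))"
    using x by (intro sum_mono mult_right_mono stirling_factor_add_le r) auto
  also have "\<dots> = stirling_factor r * x ^ r * (\<Sum>k<Suc n - r. pochhammer (3 / 2) k / fact k * x ^ k)"
    by (simp add: sum_distrib_left power_add mult_ac)
  also have "\<dots> \<le> stirling_factor r * x ^ r * (1 - x) powr (-3 / 2)"
    using x stirling_factor_pos[of r] by (intro mult_left_mono sum_pochhammer_power_le) auto
  finally show ?thesis .
qed (use x stirling_factor_pos[of r] in auto)

text \<open>
  The right side grows by \<open>1 / n! - 1 / (n + 1)!\<close>, which is at least \<open>1 / (n + 1)!\<close> for \<open>n \<ge> 1\<close>.
\<close>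

lemma sum_inverse_fact_le:
  assumes "n \<ge> 1"
  shows "(\<Sum>m=2..n. 1 / fact m) \<le> 1 - 1 / (fact n :: real)"
  using assms
proof (induction n rule: dec_induct)
  case (step n)
  then have "2 / (fact (Suc n) :: real) \<le> 1 / fact n" by (simp add: divide_simps)
  then show ?case using step by simp
qed simp

lemma stirling_factor_eq_C:
  assumes "r \<ge> 1"
  shows "stirling_factor r = real r powr (1 / 2) * (C r)\<^sup>2"
  using assms by (simp add: stirling_factor_def C_def powr_add powr_realpow)

text \<open>
  The error terms of the two approximations are square roots of the bound in
  \<open>sum_stirling_factor_power_le\<close>.
\<close>

lemma remainder_eq_sqrt:
  assumes r: "r \<ge> 1" and x: "0 \<le> x" "x < 1"
  shows "real r powr (1 / 4) * C r * x powr (real r / 2) / (1 - x) powr (3 / 4)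
    = sqrt (stirling_factor r * x ^ r * (1 - x) powr (-3 / 2))"
proof -
  have C: "C r \<ge> 0" by (simp add: C_def)
  have sq: "(y powr a)\<^sup>2 = y powr (2 * a)" for y a :: real
    by (simp add: power2_eq_square flip: powr_add)
  have "x powr real r = x ^ r" using x r by (cases "x = 0") (auto simp: powr_realpow)
  then have "(real r powr (1 / 4) * C r * x powr (real r / 2) / (1 - x) powr (3 / 4))\<^sup>2
    = stirling_factor r * x ^ r * (1 - x) powr (-3 / 2)"
    unfolding stirling_factor_eq_C[OF r]
    by (simp add: power_mult_distrib power_divide sq powr_minus_divide)
  then show ?thesis using C
    by (metis real_sqrt_unique mult_nonneg_nonneg divide_nonneg_nonneg powr_ge_zero)
qed

section \<open>Bounds for the single terms of the expansion\<close>

lemma binomial_ratio_le: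
  assumes "n \<le> N" "m \<le> n"
  shows "real (n choose m) * real N ^ m \<le> real (N choose m) * real n ^ m"
proof -
  have "real (n choose m) * real N ^ m = (\<Prod>i=0..<m. real (n - i) / real (m - i) * real N)"
    unfolding binomial_altdef_of_nat[OF \<open>m \<le> n\<close>] prod.distrib by simp
  also have "\<dots> \<le> (\<Prod>i=0..<m. real (N - i) / real (m - i) * real n)"
  proof (intro prod_mono conjI)
    fix i assume "i \<in> {0..<m}"
    then have "real (n - i) * real N \<le> real (N - i) * real n"
      using assms mult_left_mono[of "real n" "real N" "real i"] by (simp add: of_nat_diff algebra_simps)
    then show "real (n - i) / real (m - i) * real N \<le> real (N - i) / real (m - i) * real n"
      by (simp add: divide_right_mono)
  qed auto
  also have "\<dots> = real (N choose m) * real n ^ m"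
    unfolding binomial_altdef_of_nat[OF order_trans[OF \<open>m \<le> n\<close> \<open>n \<le> N\<close>]] prod.distrib by simp
  finally show ?thesis .
qed

lemma sum_centred: "N \<ge> 1 \<Longrightarrow> (\<Sum>j=1..N. centred N Z j k) = 0"
  by (simp add: centred_def col_mean_def sum_subtractf)

lemma fact_ratio: "m \<le> N \<Longrightarrow> fact (N - m) / fact N = 1 / (fact m * real (N choose m))"
  by (simp add: binomial_fact)

lemma cmod_G_le:
  assumes "m \<le> n" "n \<le> N"
  shows "cmod (G N n Z m) \<le> 1 / (fact m * real (N choose m)) * (\<Sum>K | K \<subseteq> {1..n} \<and> card K = m.
    cmod (inj_sum K {1..N} (\<lambda>k j. centred N Z j k)) * (\<Prod>k\<in>{1..n} - K. cmod (col_mean N Z k)))"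
proof -
  have "cmod (G N n Z m) = fact (N - m) / fact N * cmod (\<Sum>K | K \<subseteq> {1..n} \<and> card K = m.
    inj_sum K {1..N} (\<lambda>k j. centred N Z j k) * (\<Prod>k\<in>{1..n} - K. col_mean N Z k))"
    unfolding G_eq_sum_inj_sum[OF assms] by (simp add: norm_mult norm_divide)
  also have "\<dots> \<le> fact (N - m) / fact N * (\<Sum>K | K \<subseteq> {1..n} \<and> card K = m.
    cmod (inj_sum K {1..N} (\<lambda>k j. centred N Z j k)) * (\<Prod>k\<in>{1..n} - K. cmod (col_mean N Z k)))"
    by (intro mult_left_mono sum_norm_le) (auto simp: norm_mult prod_norm)
  finally show ?thesis using assms by (simp add: fact_ratio)
qed

definition col_variance :: "nat \<Rightarrow> (nat \<Rightarrow> nat \<Rightarrow> complex) \<Rightarrow> nat \<Rightarrow> real" where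
  "col_variance N Z k = sqnorm {1..N} (\<lambda>j. centred N Z j k) / real N"

lemma col_variance_nonneg: "col_variance N Z k \<ge> 0"
  by (simp add: col_variance_def sqnorm_nonneg)

lemma sum_col_variance: "n \<ge> 1 \<Longrightarrow> (\<Sum>k=1..n. col_variance N Z k) = real n * alpha N n Z"
proof -
  assume "n \<ge> 1"
  moreover have "(\<Sum>j=1..N. \<Sum>k=1..n. (cmod (centred N Z j k))\<^sup>2) = (\<Sum>k=1..n. \<Sum>j=1..N. (cmod (centred N Z j k))\<^sup>2)"
    by (rule sum.swap)
  ultimately show ?thesis by (simp add: alpha_def col_variance_def sqnorm_eq flip: sum_divide_distrib)
qed

lemma sum_col_mean: "n \<ge> 1 \<Longrightarrow> (\<Sum>k=1..n. (cmod (col_mean N Z k))\<^sup>2) = real n * beta N n Z"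
  by (simp add: beta_def)

lemma cmod_col_mean_le_1:
  assumes "N \<ge> 1" "\<And>j. j \<in> {1..N} \<Longrightarrow> cmod (Z j k) \<le> 1"
  shows "cmod (col_mean N Z k) \<le> 1"
proof -
  have "cmod (\<Sum>j=1..N. Z j k) \<le> (\<Sum>j=1..N. 1)" using assms(2) by (intro sum_norm_le)
  then show ?thesis using assms(1) by (simp add: col_mean_def norm_mult norm_divide field_simps)
qed

text \<open>
  Cauchy-Schwarz over the column sets costs a factor \<open>n choose m\<close>; the Hadamard type bound contributes
  \<open>1 / (N choose m)\<close>, and the quotient of the two is at most \<open>(n / N)\<^sup>m\<close>.
\<close>

lemma G_square_le:
  assumes mn: "m \<le> n" "n \<le> N" "N \<ge> 1"
  shows "(cmod (G N n Z m))\<^sup>2 \<le> stirling_factor m * (real n / real N) ^ m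
    * mixed_esym m {1..n} (col_variance N Z) (\<lambda>k. (cmod (col_mean N Z k))\<^sup>2)"
proof -
  define X where "X = (\<lambda>k j. centred N Z j k)"
  define I B where "I = (\<lambda>K. cmod (inj_sum K {1..N} X))" and "B = (\<lambda>K. \<Prod>k\<in>{1..n} - K. cmod (col_mean N Z k))"
  define c where "c = fact m * real (N choose m)"
  have c: "c > 0" using mn by (simp add: c_def)
  let ?S = "{K. K \<subseteq> {1..n} \<and> card K = m}"
  let ?W = "mixed_esym m {1..n} (col_variance N Z) (\<lambda>k. (cmod (col_mean N Z k))\<^sup>2)"
  have W: "?W \<ge> 0" by (intro mixed_esym_nonneg) (auto simp: col_variance_nonneg)
  have I: "(I K)\<^sup>2 \<le> fact m * stirling_factor m * c * (\<Prod>k\<in>K. col_variance N Z k)" if K: "K \<in> ?S" for K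
  proof -
    have "finite K" using K finite_subset by auto
    have "(I K)\<^sup>2 * real N ^ m \<le> fact m * stirling_factor m * (fact N / fact (N - m)) * (\<Prod>k\<in>K. sqnorm {1..N} (X k))"
      using inj_sum_zero_sum_columns_bound[of K "{1..N}" X] \<open>finite K\<close> K mn sum_centred[OF mn(3), of Z]
      by (simp add: I_def X_def)
    also have "fact N / fact (N - m) = c" using mn by (simp add: c_def binomial_fact)
    also have "(\<Prod>k\<in>K. sqnorm {1..N} (X k)) = (\<Prod>k\<in>K. col_variance N Z k) * real N ^ m"
      using K mn by (simp add: col_variance_def X_def prod_dividef)
    finally show ?thesis using mn by (simp add: mult.assoc[symmetric])
  qed
  have "cmod (G N n Z m) \<le> 1 / c * (\<Sum>K\<in>?S. I K * B K)"
    using cmod_G_le[OF mn(1,2), of Z] by (simp add: I_def B_def X_def c_def)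
  then have "(cmod (G N n Z m))\<^sup>2 \<le> (1 / c * (\<Sum>K\<in>?S. I K * B K))\<^sup>2"
    by (intro power_mono) auto
  also have "\<dots> = (1 / c)\<^sup>2 * (\<Sum>K\<in>?S. I K * B K)\<^sup>2" by (rule power_mult_distrib)
  also have "\<dots> \<le> (1 / c)\<^sup>2 * (real (n choose m) * (\<Sum>K\<in>?S. (I K * B K)\<^sup>2))"
    using sum_subsets_Cauchy_Schwarz[of "{1..n}", where m = m and f = "\<lambda>K. I K * B K"] by (intro mult_left_mono) auto
  also have "\<dots> \<le> (1 / c)\<^sup>2 * (real (n choose m) * (fact m * stirling_factor m * c * ?W))"
  proof (intro mult_left_mono)
    have "(\<Sum>K\<in>?S. (I K * B K)\<^sup>2) \<le> (\<Sum>K\<in>?S. fact m * stirling_factor m * c * (\<Prod>k\<in>K. col_variance N Z k) * (B K)\<^sup>2)"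
      unfolding power_mult_distrib by (intro sum_mono mult_right_mono I) auto
    also have "\<dots> = fact m * stirling_factor m * c * ?W"
      by (simp add: mixed_esym_def sum_distrib_left B_def prod_power_distrib mult.assoc)
    finally show "(\<Sum>K\<in>?S. (I K * B K)\<^sup>2) \<le> fact m * stirling_factor m * c * ?W" .
  qed auto
  also have "\<dots> = stirling_factor m * (real (n choose m) / real (N choose m)) * ?W"
    using c by (simp add: power2_eq_square) (simp add: c_def)
  also have "\<dots> \<le> stirling_factor m * (real n / real N) ^ m * ?W"
  proof (intro mult_right_mono mult_left_mono W)
    show "real (n choose m) / real (N choose m) \<le> (real n / real N) ^ m"
      using binomial_ratio_le[OF mn(2,1)] mn by (simp add: power_divide divide_simps mult_ac)
  qed (simp add: less_imp_le stirling_factor_pos)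
  finally show ?thesis .
qed

lemma min_factor_cases:
  assumes "beta N n Z \<le> 1"
  obtains "min_factor N n Z d = d * real n"
    | "beta N n Z < 1" "min_factor N n Z d = 1 / (1 - beta N n Z)"
proof -
  consider "beta N n Z = 1" | "beta N n Z < 1" "d * real n \<le> 1 / (1 - beta N n Z)"
    | "beta N n Z < 1" "1 / (1 - beta N n Z) \<le> d * real n" using assms by linarith
  then show thesis by cases (use that in \<open>auto simp: min_factor_def min_def\<close>)
qed

lemma beta_le_1:
  assumes "n \<ge> 1" "\<And>k. k \<in> {1..n} \<Longrightarrow> cmod (col_mean N Z k) \<le> 1"
  shows "beta N n Z \<le> 1"
proof -
  have "(\<Sum>k=1..n. (cmod (col_mean N Z k))\<^sup>2) \<le> (\<Sum>k=1..n. 1)"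
    using assms(2) by (intro sum_mono) (simp add: power_le_one)
  then show ?thesis using assms(1) by (simp add: beta_def field_simps)
qed

lemma alpha_nonneg: "alpha N n Z \<ge> 0"
  by (simp add: alpha_def sum_nonneg)

lemma min_factor_pos:
  assumes "beta N n Z \<le> 1" "n \<ge> 1" "d > 0"
  shows "min_factor N n Z d > 0"
  using assms by (auto simp: min_factor_def)

text \<open>
  Both alternatives of the minimum give the same bound.  For \<open>n / m\<close> it is the inequality of Maclaurin, as
  the means have modulus at most \<open>1\<close>.  For \<open>1 / (1 - \<beta>)\<close> the generating product is at most \<open>1\<close> at
  \<open>t = n (1 - \<beta>) / \<Sum>\<^sub>k u\<^sub>k\<^sup>2\<close>, and \<open>(n / m)\<^sup>m \<le> (n choose m)\<close> absorbs the missing binomial coefficient.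
\<close>

lemma mixed_esym_min_factor_bound:
  assumes n: "n \<ge> 1" and m: "m \<ge> 1" "m \<le> n" and b: "\<And>k. k \<in> {1..n} \<Longrightarrow> cmod (col_mean N Z k) \<le> 1"
  shows "(mixed_esym m {1..n} u (\<lambda>k. cmod (col_mean N Z k)))\<^sup>2
    \<le> (real (n choose m))\<^sup>2 * (real m * ((\<Sum>k=1..n. (u k)\<^sup>2) * min_factor N n Z (1 / real m)) / (real n)\<^sup>2) ^ m"
proof -
  define s \<mu> W where "s = (\<Sum>k=1..n. (u k)\<^sup>2)" and "\<mu> = min_factor N n Z (1 / real m)"
    and "W = mixed_esym m {1..n} (\<lambda>k. (u k)\<^sup>2) (\<lambda>k. (cmod (col_mean N Z k))\<^sup>2)"
  have s0: "s \<ge> 0" by (simp add: s_def sum_nonneg)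
  have W_le: "W \<le> real (n choose m) * (s / real n) ^ m"
    using mixed_esym_le_mean[of "{1..n}" "\<lambda>k. (u k)\<^sup>2" "\<lambda>k. (cmod (col_mean N Z k))\<^sup>2" m] b
    by (simp add: W_def s_def power_le_one)
  have beta: "beta N n Z \<le> 1" by (rule beta_le_1[OF n b])
  have \<mu>0: "\<mu> > 0" unfolding \<mu>_def using beta n m by (intro min_factor_pos) auto
  have eq: "real m * (s * \<mu>) / (real n)\<^sup>2 = (real m / real n) * (s * \<mu> / real n)"
    by (simp add: power2_eq_square)
  have "W \<le> real (n choose m) * (real m * (s * \<mu>) / (real n)\<^sup>2) ^ m"
    using beta
  proof (cases rule: min_factor_cases[where d = "1 / real m"])
    case 1
    then show ?thesis using W_le n m by (simp add: \<mu>_def power2_eq_square)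
  next
    case 2
    have "W \<le> (s * \<mu> / real n) ^ m"
    proof (cases "s = 0")
      case True
      then show ?thesis using W_le m by (simp add: power_0_left)
    next
      case False
      define t where "t = real n / (s * \<mu>)"
      have t: "t > 0" using False s0 \<mu>0 n by (simp add: t_def)
      have "t * s = real n * (1 - beta N n Z)" using False \<mu>0 2 by (simp add: t_def \<mu>_def)
      then have "t * s + real n * beta N n Z \<le> real n" by (simp add: algebra_simps)
      then have "W \<le> (1 / t) ^ m"
        unfolding W_def using t m n
        by (intro mixed_esym_le_power) (simp_all add: sum_col_mean s_def del: One_nat_def)
      then show ?thesis by (simp add: t_def)
    qed
    also have "\<dots> \<le> real (n choose m) * (real m / real n) ^ m * (s * \<mu> / real n) ^ m"
    proof -
      have "(real n / real m) ^ m \<le> real (n choose m)"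
        using binomial_ge_n_over_k_pow_k[of m n, where 'a = real] m by simp
      then have "1 \<le> real (n choose m) * (real m / real n) ^ m"
        using n m by (simp add: power_divide field_simps)
      then show ?thesis using s0 \<mu>0 mult_right_mono[of 1 _ "(s * \<mu> / real n) ^ m"] by simp
    qed
    also have "\<dots> = real (n choose m) * (real m * (s * \<mu>) / (real n)\<^sup>2) ^ m"
      unfolding eq by (simp only: power_mult_distrib mult.assoc)
    finally show ?thesis .
  qed
  then have "real (n choose m) * W \<le> (real (n choose m))\<^sup>2 * (real m * (s * \<mu>) / (real n)\<^sup>2) ^ m"
    using mult_left_mono[of W _ "real (n choose m)"] by (simp add: power2_eq_square mult.assoc)
  then show ?thesis
    using mixed_esym_square_le[of "{1..n}" m u "\<lambda>k. cmod (col_mean N Z k)"] by (simp add: W_def s_def \<mu>_def)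
qed

text \<open>
  The permanent of two zero-sum columns is, up to the sign, the sum of the products along the rows, which
  Cauchy-Schwarz bounds by
  \<open>N\<close> times the product of the standard deviations; the general Hadamard type bound would lose the constant.
\<close>

lemma G_2_bound:
  assumes n: "n \<ge> 2" "n \<le> N" and b: "\<And>k. k \<in> {1..n} \<Longrightarrow> cmod (col_mean N Z k) \<le> 1"
  shows "cmod (G N n Z 2) \<le> gam N n Z (1 / 2)"
proof -
  define X where "X = (\<lambda>k j. centred N Z j k)"
  define M \<alpha> \<mu> where "M = mixed_esym 2 {1..n} (\<lambda>k. sqrt (col_variance N Z k)) (\<lambda>k. cmod (col_mean N Z k))"
    and "\<alpha> = alpha N n Z" and "\<mu> = min_factor N n Z (1 / 2)"
  have beta: "beta N n Z \<le> 1" using n b by (intro beta_le_1) auto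
  have \<mu>0: "\<mu> > 0" unfolding \<mu>_def using beta n by (intro min_factor_pos) auto
  have \<alpha>0: "\<alpha> \<ge> 0" by (simp add: \<alpha>_def alpha_nonneg)
  have pair: "cmod (inj_sum K {1..N} X) \<le> real N * (\<Prod>k\<in>K. sqrt (col_variance N Z k))"
    if K: "K \<subseteq> {1..n}" "card K = 2" for K
  proof -
    obtain k l where kl: "K = {k, l}" "k \<noteq> l" using K by (meson card_2_iff)
    have "cmod (inj_sum K {1..N} X) = cmod (\<Sum>j=1..N. X k j * X l j)"
      unfolding kl(1) using kl n sum_centred[of N Z] by (subst inj_sum_pair) (simp_all add: X_def)
    also have "\<dots> \<le> (\<Sum>j=1..N. cmod (X k j) * cmod (X l j))"
      by (intro sum_norm_le) (simp add: norm_mult)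
    also have "\<dots> \<le> sqrt (sqnorm {1..N} (X k) * sqnorm {1..N} (X l))"
      unfolding sqnorm_eq by (intro real_le_rsqrt Cauchy_Schwarz_ineq_sum)
    also have "\<dots> = real N * (\<Prod>k\<in>K. sqrt (col_variance N Z k))"
      using kl n by (simp add: col_variance_def X_def real_sqrt_mult real_sqrt_divide)
    finally show ?thesis .
  qed
  have "M\<^sup>2 \<le> (real (n choose 2))\<^sup>2 * (2 * (real n * \<alpha> * \<mu>) / (real n)\<^sup>2)\<^sup>2"
    using mixed_esym_min_factor_bound[of n 2 N Z "\<lambda>k. sqrt (col_variance N Z k)"] n b sum_col_variance[of n N Z]
    by (simp add: M_def \<alpha>_def \<mu>_def col_variance_nonneg)
  also have "2 * (real n * \<alpha> * \<mu>) / (real n)\<^sup>2 = 2 * \<alpha> * \<mu> / real n"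
    using n by (simp add: power2_eq_square)
  finally have "M\<^sup>2 \<le> (real (n choose 2) * (2 * \<alpha> * \<mu> / real n))\<^sup>2"
    by (simp only: power_mult_distrib)
  then have M: "M \<le> real (n choose 2) * (2 * \<alpha> * \<mu> / real n)"
    by (rule power2_le_imp_le) (use \<alpha>0 \<mu>0 in auto)
  have "cmod (G N n Z 2) \<le> 1 / (2 * real (N choose 2)) * (\<Sum>K | K \<subseteq> {1..n} \<and> card K = 2.
      real N * (\<Prod>k\<in>K. sqrt (col_variance N Z k)) * (\<Prod>k\<in>{1..n} - K. cmod (col_mean N Z k)))"
  proof (rule order_trans[OF cmod_G_le[OF n]])
    show "1 / (fact 2 * real (N choose 2)) * (\<Sum>K | K \<subseteq> {1..n} \<and> card K = 2.
        cmod (inj_sum K {1..N} (\<lambda>k j. centred N Z j k)) * (\<Prod>k\<in>{1..n} - K. cmod (col_mean N Z k)))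
      \<le> 1 / (2 * real (N choose 2)) * (\<Sum>K | K \<subseteq> {1..n} \<and> card K = 2.
        real N * (\<Prod>k\<in>K. sqrt (col_variance N Z k)) * (\<Prod>k\<in>{1..n} - K. cmod (col_mean N Z k)))"
      unfolding fact_2
      by (intro mult_left_mono sum_mono mult_right_mono pair[unfolded X_def] prod_nonneg) auto
  qed
  also have "\<dots> = 1 / (2 * real (N choose 2)) * (real N * M)"
    by (simp only: M_def mixed_esym_def sum_distrib_left mult.assoc)
  also have "\<dots> \<le> 1 / (2 * real (N choose 2)) * (real N * (real (n choose 2) * (2 * \<alpha> * \<mu> / real n)))"
    by (intro mult_left_mono M) auto
  also have "\<dots> = (real (n choose 2) / real (N choose 2)) * (real N * (\<alpha> * \<mu>) / real n)"
    by simp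
  also have "\<dots> \<le> (real n / real N)\<^sup>2 * (real N * (\<alpha> * \<mu>) / real n)"
  proof (rule mult_right_mono)
    show "real (n choose 2) / real (N choose 2) \<le> (real n / real N)\<^sup>2"
      using binomial_ratio_le[of n N 2] n by (simp add: power_divide divide_simps mult_ac)
  qed (use \<alpha>0 \<mu>0 in auto)
  also have "\<dots> = gam N n Z (1 / 2)"
    using n by (simp add: gam_def \<alpha>_def \<mu>_def power2_eq_square)
  finally show ?thesis .
qed

lemma sqrt_cube:
  assumes "x \<ge> 0"
  shows "sqrt (x ^ 3) = x powr (3 / 2)"
proof (rule real_sqrt_unique)
  have "(x powr (3 / 2))\<^sup>2 = x powr (3 / 2 + 3 / 2)" by (simp only: power2_eq_square powr_add)
  also have "\<dots> = x ^ 3" using assms by (cases "x = 0") (auto simp: powr_numeral)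
  finally show "(x powr (3 / 2))\<^sup>2 = x ^ 3" .
qed simp

text \<open>
  The permanent of three zero-sum columns is \<open>2\<close> times the sum of the products along the rows, so that the rows
  can be estimated separately, each by \<open>mixed_esym_min_factor_bound\<close>.
\<close>

lemma G_3_bound:
  assumes n: "n \<ge> 3" "n \<le> N" and b: "\<And>k. k \<in> {1..n} \<Longrightarrow> cmod (col_mean N Z k) \<le> 1"
  shows "cmod (G N n Z 3) \<le> sqrt 3 * (\<Sum>j=1..N.
    (1 / (real N)\<^sup>2 * (\<Sum>k=1..n. (cmod (centred N Z j k))\<^sup>2 * min_factor N n Z (1 / 3))) powr (3 / 2))"
proof -
  define X where "X = (\<lambda>k j. centred N Z j k)"
  define M \<mu> s where "M = (\<lambda>j. mixed_esym 3 {1..n} (\<lambda>k. cmod (X k j)) (\<lambda>k. cmod (col_mean N Z k)))"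
    and "\<mu> = min_factor N n Z (1 / 3)" and "s = (\<lambda>j. \<Sum>k=1..n. (cmod (X k j))\<^sup>2)"
  have beta: "beta N n Z \<le> 1" using n b by (intro beta_le_1) auto
  have \<mu>0: "\<mu> > 0" unfolding \<mu>_def using beta n by (intro min_factor_pos) auto
  have s0: "s j \<ge> 0" for j by (simp add: s_def sum_nonneg)
  have triple: "cmod (inj_sum K {1..N} X) \<le> 2 * (\<Sum>j=1..N. \<Prod>k\<in>K. cmod (X k j))"
    if K: "K \<subseteq> {1..n}" "card K = 3" for K
  proof -
    obtain k l p where klp: "K = {k, l, p}" "k \<noteq> l" "k \<noteq> p" "l \<noteq> p"
      using K by (metis card_3_iff)
    have "cmod (inj_sum K {1..N} X) = 2 * cmod (\<Sum>j=1..N. X k j * X l j * X p j)"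
      unfolding klp(1) using klp n sum_centred[of N Z] by (subst inj_sum_triple) (simp_all add: X_def norm_mult)
    also have "\<dots> \<le> 2 * (\<Sum>j=1..N. \<Prod>k\<in>K. cmod (X k j))"
      using klp by (intro mult_left_mono sum_norm_le) (auto simp: norm_mult)
    finally show ?thesis .
  qed
  have M: "M j \<le> real (n choose 3) * sqrt ((3 * (s j * \<mu>) / (real n)\<^sup>2) ^ 3)" for j
  proof -
    have "(M j)\<^sup>2 \<le> (real (n choose 3))\<^sup>2 * (3 * (s j * \<mu>) / (real n)\<^sup>2) ^ 3"
      using mixed_esym_min_factor_bound[of n 3 N Z "\<lambda>k. cmod (X k j)"] n b
      by (simp add: M_def s_def \<mu>_def)
    then have "M j \<le> sqrt ((real (n choose 3))\<^sup>2 * (3 * (s j * \<mu>) / (real n)\<^sup>2) ^ 3)" by (rule real_le_rsqrt)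
    then show ?thesis by (simp add: real_sqrt_mult)
  qed
  have each: "1 / (3 * real (N choose 3)) * M j \<le> sqrt 3 * (1 / (real N)\<^sup>2 * (s j * \<mu>)) powr (3 / 2)" for j
  proof -
    define y where "y = s j * \<mu>"
    have y0: "y \<ge> 0" using s0 \<mu>0 by (simp add: y_def)
    have "1 / (3 * real (N choose 3)) * M j
      \<le> 1 / (3 * real (N choose 3)) * (real (n choose 3) * sqrt ((3 * y / (real n)\<^sup>2) ^ 3))"
      unfolding y_def by (intro mult_left_mono M) auto
    also have "\<dots> = real (n choose 3) / real (N choose 3) * (1 / 3 * sqrt ((3 * y / (real n)\<^sup>2) ^ 3))" by simp
    also have "\<dots> \<le> (real n / real N) ^ 3 * (1 / 3 * sqrt ((3 * y / (real n)\<^sup>2) ^ 3))"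
    proof (rule mult_right_mono)
      show "real (n choose 3) / real (N choose 3) \<le> (real n / real N) ^ 3"
        using binomial_ratio_le[of n N 3] n by (simp add: power_divide divide_simps mult_ac)
    qed (use y0 in auto)
    also have "\<dots> = sqrt 3 * sqrt ((1 / (real N)\<^sup>2 * y) ^ 3)"
    proof (rule power2_eq_imp_eq)
      have "((real n / real N) ^ 3 * (1 / 3 * sqrt ((3 * y / (real n)\<^sup>2) ^ 3)))\<^sup>2
        = ((real n / real N) ^ 3)\<^sup>2 * ((1 / 3)\<^sup>2 * (3 * y / (real n)\<^sup>2) ^ 3)"
        using y0 by (simp only: power_mult_distrib) simp
      also have "\<dots> = 3 * (1 / (real N)\<^sup>2 * y) ^ 3"
        using n by (simp add: power_mult_distrib power_divide flip: power_mult)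
      also have "\<dots> = (sqrt 3 * sqrt ((1 / (real N)\<^sup>2 * y) ^ 3))\<^sup>2"
        using y0 by (simp only: power_mult_distrib) simp
      finally show "((real n / real N) ^ 3 * (1 / 3 * sqrt ((3 * y / (real n)\<^sup>2) ^ 3)))\<^sup>2 = (sqrt 3 * sqrt ((1 / (real N)\<^sup>2 * y) ^ 3))\<^sup>2" .
    qed (use y0 in auto)
    also have "sqrt ((1 / (real N)\<^sup>2 * y) ^ 3) = (1 / (real N)\<^sup>2 * y) powr (3 / 2)"
      using y0 by (intro sqrt_cube) simp
    finally show ?thesis by (simp add: y_def)
  qed
  have "cmod (G N n Z 3) \<le> 1 / (6 * real (N choose 3)) * (\<Sum>K | K \<subseteq> {1..n} \<and> card K = 3.
      2 * (\<Sum>j=1..N. \<Prod>k\<in>K. cmod (X k j)) * (\<Prod>k\<in>{1..n} - K. cmod (col_mean N Z k)))"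
  proof (rule order_trans[OF cmod_G_le[OF n]])
    have "fact 3 = (6 :: real)" by (simp add: fact_numeral)
    then show "1 / (fact 3 * real (N choose 3)) * (\<Sum>K | K \<subseteq> {1..n} \<and> card K = 3.
        cmod (inj_sum K {1..N} (\<lambda>k j. centred N Z j k)) * (\<Prod>k\<in>{1..n} - K. cmod (col_mean N Z k)))
      \<le> 1 / (6 * real (N choose 3)) * (\<Sum>K | K \<subseteq> {1..n} \<and> card K = 3.
        2 * (\<Sum>j=1..N. \<Prod>k\<in>K. cmod (X k j)) * (\<Prod>k\<in>{1..n} - K. cmod (col_mean N Z k)))"
      using triple unfolding X_def
      by (simp only:) (intro mult_left_mono sum_mono mult_right_mono prod_nonneg; simp)
  qed
  also have "(\<Sum>K | K \<subseteq> {1..n} \<and> card K = 3. 2 * (\<Sum>j=1..N. \<Prod>k\<in>K. cmod (X k j)) * (\<Prod>k\<in>{1..n} - K. cmod (col_mean N Z k)))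
    = 2 * (\<Sum>j=1..N. M j)"
    unfolding M_def mixed_esym_def by (subst sum.swap) (simp add: sum_distrib_left sum_distrib_right mult.assoc)
  also have "1 / (6 * real (N choose 3)) * (2 * (\<Sum>j=1..N. M j)) = (\<Sum>j=1..N. 1 / (3 * real (N choose 3)) * M j)"
    by (simp add: sum_divide_distrib)
  also have "\<dots> \<le> (\<Sum>j=1..N. sqrt 3 * (1 / (real N)\<^sup>2 * (s j * \<mu>)) powr (3 / 2))"
    by (intro sum_mono each)
  also have "\<dots> = sqrt 3 * (\<Sum>j=1..N.
    (1 / (real N)\<^sup>2 * (\<Sum>k=1..n. (cmod (centred N Z j k))\<^sup>2 * min_factor N n Z (1 / 3))) powr (3 / 2))"
    by (simp only: sum_distrib_left sum_distrib_right s_def \<mu>_def X_def)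
  finally show ?thesis .
qed

lemma G_0: "n \<le> N \<Longrightarrow> G N n Z 0 = (\<Prod>k=1..n. col_mean N Z k)"
proof -
  assume "n \<le> N"
  moreover have "{K. K \<subseteq> {1..n} \<and> card K = 0} = {{}}" by (auto dest: finite_subset)
  ultimately show ?thesis by (simp add: G_eq_sum_inj_sum)
qed

lemma G_1:
  assumes "1 \<le> n" "n \<le> N"
  shows "G N n Z 1 = 0"
proof -
  have "inj_sum K {1..N} (\<lambda>k j. centred N Z j k) = 0" if "card K = 1" for K
  proof -
    obtain k where "K = {k}" using \<open>card K = 1\<close> by (rule card_1_singletonE)
    then show ?thesis using sum_centred[of N Z k] assms by (simp only: inj_sum_single finite_atLeastAtMost)
  qed
  then show ?thesis unfolding G_eq_sum_inj_sum[OF assms] by simp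
qed

section \<open>The tail and the final estimate\<close>

text \<open>
  If \<open>\<alpha> = 0\<close>, all the terms vanish.  Otherwise, with \<open>t = 1 / (\<alpha> \<mu>)\<close>, where \<open>\<mu>\<close> is the minimum in \<open>\<gamma>\<close>, the bound for \<open>|G\<^sub>m|\<^sup>2\<close> splits into
  \<open>stirling_factor m * \<gamma> ^ m\<close> and the weight \<open>t ^ m * W m\<close>.  The weights have sum at most \<open>1\<close>, hence
  Cauchy-Schwarz over \<open>m\<close> leaves the remainder series alone.
\<close>

lemma tail_bound:
  assumes n: "n \<ge> 1" "n \<le> N" and b: "\<And>k. k \<in> {1..n} \<Longrightarrow> cmod (col_mean N Z k) \<le> 1"
    and gam: "gam N n Z 1 < 1" and r: "r \<ge> 2"
  shows "(\<Sum>m=r..n. cmod (G N n Z m))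
    \<le> sqrt (stirling_factor r * gam N n Z 1 ^ r * (1 - gam N n Z 1) powr (-3 / 2))"
proof -
  define \<alpha> \<mu> g where "\<alpha> = alpha N n Z" and "\<mu> = min_factor N n Z 1" and "g = gam N n Z 1"
  have N: "N \<ge> 1" using n by simp
  have beta: "beta N n Z \<le> 1" by (rule beta_le_1[OF n(1) b])
  have \<mu>: "\<mu> > 0" unfolding \<mu>_def using beta n by (intro min_factor_pos) auto
  have \<alpha>0: "\<alpha> \<ge> 0" by (simp add: \<alpha>_def alpha_nonneg)
  have g: "g = real n / real N * (\<alpha> * \<mu>)" by (simp add: g_def gam_def \<alpha>_def \<mu>_def)
  have g0: "g \<ge> 0" using \<mu> \<alpha>0 by (simp add: g)
  define W where "W = (\<lambda>m. mixed_esym m {1..n} (col_variance N Z) (\<lambda>k. (cmod (col_mean N Z k))\<^sup>2))"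
  have W0: "W m \<ge> 0" for m unfolding W_def by (intro mixed_esym_nonneg) (auto simp: col_variance_nonneg)
  have W_le: "W m \<le> real (n choose m) * \<alpha> ^ m" for m
    using mixed_esym_le_mean[of "{1..n}" "col_variance N Z" "\<lambda>k. (cmod (col_mean N Z k))\<^sup>2" m] n b sum_col_variance[OF n(1), of N Z]
    by (simp add: W_def \<alpha>_def col_variance_nonneg power_le_one)
  have G: "(cmod (G N n Z m))\<^sup>2 \<le> stirling_factor m * (real n / real N) ^ m * W m" if "m \<le> n" for m
    unfolding W_def by (rule G_square_le[OF that n(2) N])
  show ?thesis
  proof (cases "\<alpha> = 0")
    case True
    have "cmod (G N n Z m) = 0" if "m \<in> {r..n}" for m
    proof -
      have "W m \<le> 0" using W_le[of m] True that r by (simp add: power_0_left)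
      then have "W m = 0" using W0[of m] by simp
      then have "(cmod (G N n Z m))\<^sup>2 \<le> 0" using G[of m] that by simp
      then show ?thesis by simp
    qed
    then have "(\<Sum>m=r..n. cmod (G N n Z m)) = 0" by (intro sum.neutral) auto
    then show ?thesis using g0 stirling_factor_pos[of r] by (simp add: g_def less_imp_le)
  next
    case False
    then have \<alpha>: "\<alpha> > 0" using \<alpha>0 by simp
    define t where "t = 1 / (\<alpha> * \<mu>)"
    have t: "t > 0" "t * \<alpha> = 1 / \<mu>" using \<alpha> \<mu> by (auto simp: t_def)
    have gt: "g * t = real n / real N" using \<alpha> \<mu> by (simp add: g t_def)
    have "beta N n Z \<le> 1" by (rule beta)
    then have weights: "(\<Sum>m=r..n. t ^ m * W m) \<le> 1"
    proof (cases rule: min_factor_cases[where d = 1])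
      case 1
      have "t ^ m * W m \<le> 1 / fact m" if "m \<in> {r..n}" for m
      proof -
        have "t ^ m * W m \<le> t ^ m * (real (n choose m) * \<alpha> ^ m)"
          using t W_le[of m] by (intro mult_left_mono) auto
        also have "\<dots> = real (n choose m) * (t * \<alpha>) ^ m" by (simp add: power_mult_distrib)
        also have "\<dots> = real (n choose m) * (1 / real n) ^ m"
          unfolding t using 1 by (simp add: \<mu>_def)
        also have "\<dots> \<le> 1 / fact m"
        proof -
          have "fact m * (n choose m) \<le> n ^ m"
            using binomial_fact_pow[of n m] by (simp add: mult.commute)
          then have "real (fact m * (n choose m)) \<le> real (n ^ m)" by (rule of_nat_mono)
          then show ?thesis using n by (simp add: power_divide field_simps)
        qed
        finally show ?thesis .
      qed
      then have "(\<Sum>m=r..n. t ^ m * W m) \<le> (\<Sum>m=r..n. 1 / fact m)" by (intro sum_mono) auto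
      also have "\<dots> \<le> (\<Sum>m=2..n. 1 / fact m)" using r by (intro sum_mono2) auto
      also have "\<dots> \<le> 1" using sum_inverse_fact_le[OF n(1)] by (smt (verit) fact_gt_zero zero_le_divide_1_iff)
      finally show ?thesis .
    next
      case 2
      have "(\<Sum>m=r..n. t ^ m * W m) \<le> (\<Sum>m\<le>n. t ^ m * W m)"
        using t W0 by (intro sum_mono2) auto
      also have "\<dots> \<le> 1"
      proof -
        have "t * (real n * \<alpha>) + real n * beta N n Z = real n * (t * \<alpha> + beta N n Z)"
          by (simp add: algebra_simps)
        also have "\<dots> = real n" unfolding t using 2 by (simp add: \<mu>_def)
        finally have "t * (real n * \<alpha>) + real n * beta N n Z = real n" .
        then show ?thesis
          using sum_mixed_esym_le_1[of "{1..n}" "col_variance N Z" "\<lambda>k. (cmod (col_mean N Z k))\<^sup>2" t] n t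
          by (simp add: W_def col_variance_nonneg sum_col_variance sum_col_mean \<alpha>_def del: One_nat_def)
      qed
      finally show ?thesis .
    qed
    have "cmod (G N n Z m) \<le> sqrt (stirling_factor m * g ^ m) * sqrt (t ^ m * W m)" if "m \<in> {r..n}" for m
    proof -
      have "(cmod (G N n Z m))\<^sup>2 \<le> (stirling_factor m * g ^ m) * (t ^ m * W m)"
        using G[of m] that by (simp add: gt[symmetric] power_mult_distrib mult_ac)
      then show ?thesis by (simp add: real_le_rsqrt flip: real_sqrt_mult)
    qed
    then have "(\<Sum>m=r..n. cmod (G N n Z m)) \<le> (\<Sum>m=r..n. sqrt (stirling_factor m * g ^ m) * sqrt (t ^ m * W m))"
      by (rule sum_mono)
    also have "\<dots> \<le> sqrt ((\<Sum>m=r..n. stirling_factor m * g ^ m) * (\<Sum>m=r..n. t ^ m * W m))"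
    proof (rule real_le_rsqrt)
      have "(\<Sum>m=r..n. sqrt (stirling_factor m * g ^ m) * sqrt (t ^ m * W m))\<^sup>2
        \<le> (\<Sum>m=r..n. (sqrt (stirling_factor m * g ^ m))\<^sup>2) * (\<Sum>m=r..n. (sqrt (t ^ m * W m))\<^sup>2)"
        by (rule Cauchy_Schwarz_ineq_sum)
      then show "(\<Sum>m=r..n. sqrt (stirling_factor m * g ^ m) * sqrt (t ^ m * W m))\<^sup>2
        \<le> (\<Sum>m=r..n. stirling_factor m * g ^ m) * (\<Sum>m=r..n. t ^ m * W m)"
        using g0 t W0 by (simp add: less_imp_le stirling_factor_pos)
    qed
    also have "\<dots> \<le> sqrt ((\<Sum>m=r..n. stirling_factor m * g ^ m) * 1)"
      using weights g0 by (intro real_sqrt_le_mono mult_left_mono sum_nonneg) (auto simp: less_imp_le stirling_factor_pos)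
    also have "\<dots> \<le> sqrt (stirling_factor r * g ^ r * (1 - g) powr (-3 / 2))"
      using sum_stirling_factor_power_le[of r g n] r g0 gam by (intro real_sqrt_le_mono) (auto simp: g_def)
    finally show ?thesis by (simp add: g_def)
  qed
qed

theorem corollary2p12:
  fixes N n :: nat and Z :: "nat \<Rightarrow> nat \<Rightarrow> complex"
  assumes "N \<ge> 1" and "n \<in> {1..N}"
    and "\<And>j k. j \<in> {1..N} \<Longrightarrow> k \<in> {1..n} \<Longrightarrow> cmod (Z j k) \<le> 1"
    and "gam N n Z 1 < 1"
  shows
    "cmod (fact (N - n) / fact N * Per N n Z - (\<Prod>k=1..n. col_mean N Z k))
       \<le> gam N n Z (1 / 2)
         + 3 powr (1 / 4) * C 3 * gam N n Z 1 powr (3 / 2) / (1 - gam N n Z 1) powr (3 / 4)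
     \<and>
     (n \<ge> 2 \<longrightarrow>
       cmod (fact (N - n) / fact N * Per N n Z - H2 N n Z)
         \<le> sqrt 3 * (\<Sum>j=1..N.
               (1 / (real N)\<^sup>2 * (\<Sum>k=1..n. (cmod (centred N Z j k))\<^sup>2 * min_factor N n Z (1 / 3)))
                 powr (3 / 2))
           + sqrt 2 * C 4 * (gam N n Z 1)\<^sup>2 / (1 - gam N n Z 1) powr (3 / 4))"
proof -
  define g where "g = gam N n Z 1"
  have n: "n \<ge> 1" "n \<le> N" using assms(2) by auto
  have b: "cmod (col_mean N Z k) \<le> 1" if "k \<in> {1..n}" for k
    using assms(1,3) that by (intro cmod_col_mean_le_1) auto
  have beta: "beta N n Z \<le> 1" using n b by (intro beta_le_1) auto
  have gam0: "gam N n Z d \<ge> 0" if "d > 0" for d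
    using min_factor_pos[OF beta n(1) that] alpha_nonneg[of N n Z] by (simp add: gam_def)
  have g: "0 \<le> g" "g < 1" using gam0[of 1] assms(4) by (auto simp: g_def)
  have tail: "cmod (\<Sum>m=r..n. G N n Z m) \<le> real r powr (1 / 4) * C r * g powr (real r / 2) / (1 - g) powr (3 / 4)"
    if "r \<ge> 2" for r
  proof -
    have "cmod (\<Sum>m=r..n. G N n Z m) \<le> (\<Sum>m=r..n. cmod (G N n Z m))" by (rule norm_sum)
    also have "\<dots> \<le> sqrt (stirling_factor r * g ^ r * (1 - g) powr (-3 / 2))"
      unfolding g_def by (rule tail_bound[OF n b assms(4) that])
    finally show ?thesis using remainder_eq_sqrt[of r g] g that by simp
  qed
  define P where "P = fact (N - n) / fact N * Per N n Z"
  have P: "P = (\<Sum>m=0..n. G N n Z m)" unfolding P_def by (rule Per_eq_sum_G[OF n(2)])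
  have split: "(\<Sum>m=i..n. G N n Z m) = (if i \<le> n then G N n Z i else 0) + (\<Sum>m=Suc i..n. G N n Z m)" for i
    by (simp add: sum.atLeast_Suc_atMost)
  have P1: "P - (\<Prod>k=1..n. col_mean N Z k) = (\<Sum>m=2..n. G N n Z m)"
    unfolding P split[of 0] using split[of 1] n G_0[of n N Z] G_1[of n N Z] by (simp add: numeral_2_eq_2)
  have "cmod (P - (\<Prod>k=1..n. col_mean N Z k)) \<le> gam N n Z (1 / 2)
      + 3 powr (1 / 4) * C 3 * g powr (3 / 2) / (1 - g) powr (3 / 4)"
  proof -
    have 1: "cmod (if 2 \<le> n then G N n Z 2 else 0) \<le> gam N n Z (1 / 2)"
      using G_2_bound[OF _ n(2) b] gam0[of "1 / 2"] by simp
    have 2: "cmod (\<Sum>m=3..n. G N n Z m) \<le> 3 powr (1 / 4) * C 3 * g powr (3 / 2) / (1 - g) powr (3 / 4)"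
      using tail[of 3] by simp
    have 3: "(\<Sum>m=2..n. G N n Z m) = (if 2 \<le> n then G N n Z 2 else 0) + (\<Sum>m=3..n. G N n Z m)"
      using split[of 2] by simp
    show ?thesis unfolding P1 3 by (rule norm_triangle_le[OF add_mono[OF 1 2]])
  qed
  moreover have "cmod (P - H2 N n Z) \<le> sqrt 3 * (\<Sum>j=1..N.
        (1 / (real N)\<^sup>2 * (\<Sum>k=1..n. (cmod (centred N Z j k))\<^sup>2 * min_factor N n Z (1 / 3))) powr (3 / 2))
      + sqrt 2 * C 4 * g\<^sup>2 / (1 - g) powr (3 / 4)" (is "_ \<le> ?T + ?E") if "n \<ge> 2"
  proof -
    have "?T \<ge> 0" by (intro mult_nonneg_nonneg sum_nonneg) auto
    then have 1: "cmod (if 3 \<le> n then G N n Z 3 else 0) \<le> ?T"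
      using G_3_bound[OF _ n(2) b] by simp
    have 2: "cmod (\<Sum>m=4..n. G N n Z m) \<le> ?E"
    proof -
      have "(4::real) powr (1 / 4) = sqrt 2"
        using powr_powr[of 2 2 "1 / 4 :: real"] by (simp add: powr_half_sqrt)
      moreover have "g powr 2 = g\<^sup>2" using g by (cases "g = 0") (auto simp: powr_numeral)
      ultimately show ?thesis using tail[of 4] by simp
    qed
    have 3: "P - H2 N n Z = (if 3 \<le> n then G N n Z 3 else 0) + (\<Sum>m=4..n. G N n Z m)"
    proof -
      have "{0..n} = {0..2} \<union> {3..n}" using that by auto
      then have "P = H2 N n Z + (\<Sum>m=3..n. G N n Z m)"
        unfolding P H2_def by (simp add: sum.union_disjoint)
      then show ?thesis using split[of 3] by simp
    qed
    show ?thesis unfolding 3 by (rule norm_triangle_le[OF add_mono[OF 1 2]])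
  qed
  ultimately show ?thesis by (simp add: P_def g_def)
qed

end
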